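(* Let $q$ be a fixed power of $2$, and let $i_{Sp}(2n,q)$ be the number of involutions in $Sp(2n,q)$. Then $$\lim_{n \rightarrow \infty} \frac{i_{Sp}(2n,q)}{q^{n^2+n}} = \prod_{i \geq 1} \left(1+\frac{1}{q^{2i}}\right).$$
   Context: $Sp(2n,q)$ is the symplectic group of a nondegenerate alternating bilinear form on the $2n$-dimensional vector space over the finite field with $q$ elements. "Involution" means an element $g$ with $g^2=1$ (the identity is counted). *)

theory Defs
  imports "HOL-Analysis.Infinite_Products" "Jordan_Normal_Form.Matrix"
begin

text \<open>
  The vector space of dimension \<open>m\<close> over the field \<open>'a\<close> is \<open>carrier_vec m\<close>, and linear
  endomorphisms are elements of \<open>carrier_mat m m\<close>. The dimension is thus an ordinary natural number
  and may tend to infinity. The values of a form \<open>B\<close> outside \<open>carrier_vec m\<close> are irrelevant.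
\<close>

definition bilinear_form :: "nat \<Rightarrow> ('a::field vec \<Rightarrow> 'a vec \<Rightarrow> 'a) \<Rightarrow> bool" where
  "bilinear_form m B \<longleftrightarrow>
     (\<forall>x\<in>carrier_vec m. \<forall>y\<in>carrier_vec m. \<forall>z\<in>carrier_vec m.
        B (x + y) z = B x z + B y z \<and> B z (x + y) = B z x + B z y) \<and>
     (\<forall>c. \<forall>x\<in>carrier_vec m. \<forall>y\<in>carrier_vec m.
        B (c \<cdot>\<^sub>v x) y = c * B x y \<and> B x (c \<cdot>\<^sub>v y) = c * B x y)"

text \<open>
  In characteristic 2 alternating (\<open>B x x = 0\<close>) is strictly stronger than skew-symmetric.
\<close>

definition alternating_form :: "nat \<Rightarrow> ('a::field vec \<Rightarrow> 'a vec \<Rightarrow> 'a) \<Rightarrow> bool" where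
  "alternating_form m B \<longleftrightarrow> bilinear_form m B \<and> (\<forall>x\<in>carrier_vec m. B x x = 0)"

text \<open>
  For alternating forms the left and the right radical coincide, so it suffices that the left
  radical is trivial.
\<close>

definition nondegenerate_form :: "nat \<Rightarrow> ('a::field vec \<Rightarrow> 'a vec \<Rightarrow> 'a) \<Rightarrow> bool" where
  "nondegenerate_form m B \<longleftrightarrow>
     (\<forall>x\<in>carrier_vec m. (\<forall>y\<in>carrier_vec m. B x y = 0) \<longrightarrow> x = 0\<^sub>v m)"

definition symplectic_group :: "nat \<Rightarrow> ('a::field vec \<Rightarrow> 'a vec \<Rightarrow> 'a) \<Rightarrow> 'a mat monoid" where
  "symplectic_group m B =
     \<lparr>carrier = {g \<in> carrier_mat m m. invertible_mat g \<and>
         (\<forall>x\<in>carrier_vec m. \<forall>y\<in>carrier_vec m. B (g *\<^sub>v x) (g *\<^sub>v y) = B x y)},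
      mult = (*), one = 1\<^sub>m m\<rparr>"

text \<open>The identity is counted as an involution.\<close>

definition involutions :: "('g, 'b) monoid_scheme \<Rightarrow> 'g set" where
  "involutions G = {g \<in> carrier G. g \<otimes>\<^bsub>G\<^esub> g = \<one>\<^bsub>G\<^esub>}"

lemma group_symplectic_group: "group (symplectic_group m B)"
proof (rule groupI)
  let ?G = "symplectic_group m B"
  show "\<one>\<^bsub>?G\<^esub> \<in> carrier ?G"
    by (auto simp: symplectic_group_def invertible_mat_def inverts_mat_def
        intro!: exI[of _ "1\<^sub>m m"])
  fix g assume g: "g \<in> carrier ?G"
  show "\<one>\<^bsub>?G\<^esub> \<otimes>\<^bsub>?G\<^esub> g = g"
    using g by (auto simp: symplectic_group_def)
  have gc: "g \<in> carrier_mat m m"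
    and gB: "\<And>x y. x \<in> carrier_vec m \<Longrightarrow> y \<in> carrier_vec m \<Longrightarrow> B (g *\<^sub>v x) (g *\<^sub>v y) = B x y"
    using g by (auto simp: symplectic_group_def)
  obtain h where gh: "g * h = 1\<^sub>m m" and hg': "h * g = 1\<^sub>m (dim_row h)"
    using g by (auto simp: symplectic_group_def invertible_mat_def inverts_mat_def)
  have hc: "h \<in> carrier_mat m m"
    using gc arg_cong[OF gh, of dim_col] arg_cong[OF hg', of dim_col] by auto
  have hg: "h * g = 1\<^sub>m m" using hg' hc by auto
  have hB: "B (h *\<^sub>v x) (h *\<^sub>v y) = B x y"
    if "x \<in> carrier_vec m" "y \<in> carrier_vec m" for x y
  proof -
    have gv: "g *\<^sub>v (h *\<^sub>v z) = z" if "z \<in> carrier_vec m" for z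
      using that gh assoc_mult_mat_vec[OF gc hc that] by simp
    show ?thesis
      using gB[of "h *\<^sub>v x" "h *\<^sub>v y"] that hc gv by auto
  qed
  have "h \<in> carrier ?G"
    using hc gc gh hg hB
    by (auto simp: symplectic_group_def invertible_mat_def inverts_mat_def intro!: exI[of _ g])
  then show "\<exists>h\<in>carrier ?G. h \<otimes>\<^bsub>?G\<^esub> g = \<one>\<^bsub>?G\<^esub>"
    using hg by (auto simp: symplectic_group_def)
next
  let ?G = "symplectic_group m B"
  fix g h assume g: "g \<in> carrier ?G" and h: "h \<in> carrier ?G"
  have gc: "g \<in> carrier_mat m m" and hc: "h \<in> carrier_mat m m"
    using g h by (auto simp: symplectic_group_def)
  have inv: "\<exists>k\<in>carrier_mat m m. f * k = 1\<^sub>m m \<and> k * f = 1\<^sub>m m"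
    if f: "f \<in> carrier ?G" for f
  proof -
    have fc: "f \<in> carrier_mat m m" using f by (auto simp: symplectic_group_def)
    obtain k where k: "f * k = 1\<^sub>m m" "k * f = 1\<^sub>m (dim_row k)"
      using f by (auto simp: symplectic_group_def invertible_mat_def inverts_mat_def)
    have kc: "k \<in> carrier_mat m m"
      using fc arg_cong[OF k(1), of dim_col] arg_cong[OF k(2), of dim_col] by auto
    show ?thesis using k kc by auto
  qed
  obtain g' where g': "g' \<in> carrier_mat m m" "g * g' = 1\<^sub>m m" "g' * g = 1\<^sub>m m"
    using inv[OF g] by auto
  obtain h' where h': "h' \<in> carrier_mat m m" "h * h' = 1\<^sub>m m" "h' * h = 1\<^sub>m m"
    using inv[OF h] by auto
  have eq: "(a * b) * (b' * a') = 1\<^sub>m m"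
    if "a \<in> carrier_mat m m" "b \<in> carrier_mat m m" "a' \<in> carrier_mat m m" "b' \<in> carrier_mat m m"
      "a * a' = 1\<^sub>m m" "b * b' = 1\<^sub>m m" for a b a' b' :: "'a mat"
  proof -
    have "(a * b) * (b' * a') = a * (b * (b' * a'))"
      using that by (intro assoc_mult_mat) auto
    also have "b * (b' * a') = (b * b') * a'"
      using that by (intro assoc_mult_mat[symmetric]) auto
    finally show ?thesis using that by simp
  qed
  have "invertible_mat (g * h)"
    using gc hc g' h' eq[OF gc hc g'(1) h'(1)] eq[OF h'(1) g'(1) hc gc]
    by (auto simp: invertible_mat_def inverts_mat_def intro!: exI[of _ "h' * g'"])
  moreover have "B (g * h *\<^sub>v x) (g * h *\<^sub>v y) = B x y"
    if "x \<in> carrier_vec m" "y \<in> carrier_vec m" for x y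
    using g h that by (auto simp: symplectic_group_def)
  ultimately show "g \<otimes>\<^bsub>?G\<^esub> h \<in> carrier ?G"
    using gc hc by (auto simp: symplectic_group_def)
qed (auto simp: symplectic_group_def)

text \<open>Nondegenerate alternating forms exist in every even dimension.\<close>

lemma nondegenerate_alternating_form_exists:
  "\<exists>B :: 'a::field vec \<Rightarrow> 'a vec \<Rightarrow> 'a. alternating_form (2 * n) B \<and> nondegenerate_form (2 * n) B"
proof -
  define B :: "'a vec \<Rightarrow> 'a vec \<Rightarrow> 'a" where
    "B x y = (\<Sum>i<n. x $ i * y $ (n + i) - x $ (n + i) * y $ i)" for x y
  have "alternating_form (2 * n) B"
    unfolding alternating_form_def bilinear_form_def B_def
    by (auto simp: sum.distrib[symmetric] sum_distrib_left algebra_simps intro!: sum.cong)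
  moreover have "x = 0\<^sub>v (2 * n)"
    if x: "x \<in> carrier_vec (2 * n)" and zero: "\<forall>y\<in>carrier_vec (2 * n). B x y = 0" for x
  proof (rule eq_vecI)
    fix j assume "j < dim_vec (0\<^sub>v (2 * n) :: 'a vec)"
    then have j: "j < 2 * n" by simp
    show "x $ j = 0\<^sub>v (2 * n) $ j"
    proof (cases "j < n")
      case True
      have "B x (unit_vec (2 * n) (n + j)) = (\<Sum>i<n. if i = j then x $ j else 0)"
        unfolding B_def using True by (intro sum.cong) auto
      then show ?thesis using zero True by simp
    next
      case False
      then obtain i where i: "j = n + i" "i < n"
        using j by (metis add_less_cancel_left le_Suc_ex mult_2 not_less)
      have "B x (unit_vec (2 * n) i) = (\<Sum>k<n. if k = i then - x $ j else 0)"
        unfolding B_def using i by (intro sum.cong) auto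
      then show ?thesis using zero i by simp
    qed
  qed (use x in simp)
  ultimately show ?thesis unfolding nondegenerate_form_def by blast
qed

end

theory Submission
  imports Defs "HOL-Library.Function_Algebras" "HOL-Analysis.Uniform_Limit"
begin

text \<open>
  In characteristic 2 the map \<open>g = 1 + N\<close> is a symplectic involution iff \<open>N\<close> is self-adjoint and
  \<open>N N = 0\<close>. Fix \<open>j\<close> and consider the maps \<open>N\<close> with kernel of dimension \<open>n + j\<close> on a symplectic space
  of dimension \<open>2 n\<close>. If \<open>w = N e \<noteq> 0\<close>, then either \<open>B w e \<noteq> 0\<close> and \<open>N\<close> splits off the plane spanned by
  \<open>e, w\<close>, or \<open>B w e = 0\<close> and, for any \<open>h\<close> with \<open>B e h = 0\<close> and \<open>B w h = 1\<close>, it splits off the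
  nondegenerate 4-space spanned by \<open>e, h, w, N h\<close>; what remains is a map of the same kind with the same
  \<open>j\<close> in dimension \<open>2 (n - 1)\<close> or \<open>2 (n - 2)\<close>. Double counting the pairs \<open>(N, e)\<close> with \<open>N e \<noteq> 0\<close>
  therefore gives a two-step recurrence in \<open>n\<close>, whose solution is
  \<open>q ^ (n\<^sup>2 + n) x ^ (j (j + 1) / 2) (x)_n / ((x)_j (x)_m)\<close>, where \<open>x = 1 / q\<^sup>2\<close>,
  \<open>m = (n - j) div 2\<close> and \<open>(x)_n = (1 - x) \<dots> (1 - x ^ n)\<close>. Summing over \<open>j\<close> and letting \<open>n\<close>
  tend to infinity gives \<open>\<Sum>j. x ^ (j (j + 1) / 2) / (x)_j\<close>, which is \<open>\<Prod>i\<ge>1. 1 + x ^ i\<close> by Euler.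
\<close>

subsection \<open>Square-zero self-adjoint maps on symplectic spaces\<close>

lemma card_field_gt_1: "CARD('a::{field,finite}) > 1"
proof -
  have "card {0, 1::'a} \<le> CARD('a)" by (rule card_mono) auto
  then show ?thesis by simp
qed

text \<open>Dimensions are measured by cardinalities throughout; this recovers the dimension of a
  complement from a product of cardinalities.\<close>

lemma power_eq_power_mult:
  fixes q :: nat
  assumes "q > 1" and e: "q ^ (2 * n) = q ^ (2 * k) * c"
  shows "k \<le> n \<and> c = q ^ (2 * (n - k))"
proof
  have "c > 0" using assms by (intro gr0I) auto
  then have "q ^ (2 * k) \<le> q ^ (2 * n)" unfolding e by simp
  then have "2 * k \<le> 2 * n" by (rule power_le_imp_le_exp[OF assms(1)])
  then show le: "k \<le> n" by simp
  have "q ^ (2 * n) = q ^ (2 * k) * q ^ (2 * (n - k))"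
    using le by (simp flip: power_add add_mult_distrib2)
  then show "c = q ^ (2 * (n - k))" using assms by simp
qed

lemma card_eq_sum_fibres:
  assumes "finite S" "finite T" "f ` S \<subseteq> T"
  shows "card S = (\<Sum>t\<in>T. card {x\<in>S. f x = t})"
  using sum.group[OF assms, of "\<lambda>_. 1::nat"] by simp

text \<open>The form lives on an ambient space whose dimension is not restricted. Symplectic spaces
  are subsets of it, so an induction can pass to orthogonal complements without a change of
  type.\<close>

locale char2_alternating = vector_space scale
  for scale :: "'a::{field,finite} \<Rightarrow> 'v::ab_group_add \<Rightarrow> 'v" (infixr "\<star>" 75) +
  fixes B :: "'v \<Rightarrow> 'v \<Rightarrow> 'a"
  assumes B_add_left: "B (x + y) z = B x z + B y z"
    and B_add_right: "B x (y + z) = B x y + B x z"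
    and B_scale_left: "B (c \<star> x) y = c * B x y"
    and B_scale_right: "B x (c \<star> y) = c * B x y"
    and B_self [simp]: "B x x = 0"
    and char2: "(1::'a) + 1 = 0"
begin

lemmas B_simps = B_add_left B_add_right B_scale_left B_scale_right

lemma add_self_scalar [simp]: "a + a = (0::'a)"
  using char2 by (metis distrib_left mult_1_right mult_zero_right)

lemma add_add_self_scalar [simp]: "a + (a + b) = (b::'a)"
  by (simp flip: add.assoc)

lemma add_eq_0_scalar: "a + b = 0 \<longleftrightarrow> a = (b::'a)"
  by (metis add_self_scalar add_left_cancel)

lemma add_self [simp]: "x + x = (0::'v)"
  by (metis add_self_scalar scale_left_distrib scale_one scale_zero_left)

lemma add_add_self [simp]: "x + (x + y) = (y::'v)"
  by (simp flip: add.assoc)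

lemma add_eq_0: "x + y = 0 \<longleftrightarrow> x = (y::'v)"
  by (metis add_self add_left_cancel)

lemma B_sym: "B x y = B y x"
proof -
  have "B x y + B y x = B (x + y) (x + y)" by (simp only: B_add_left B_add_right) simp
  then show ?thesis by (simp add: add_eq_0_scalar)
qed

lemma B_zero [simp]: "B 0 x = 0" "B x 0 = 0"
  using B_scale_left[of 0 0 x] B_scale_right[of x 0 0] by simp_all

definition nondegenerate_on :: "'v set \<Rightarrow> bool" where
  "nondegenerate_on V \<longleftrightarrow> (\<forall>x\<in>V. (\<forall>y\<in>V. B x y = 0) \<longrightarrow> x = 0)"

text \<open>The cardinality encodes the dimension; \<open>n\<close> is half of it, the parameter of
  all inductions below.\<close>

definition symplectic_space :: "nat \<Rightarrow> 'v set \<Rightarrow> bool" where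
  "symplectic_space n V \<longleftrightarrow> subspace V \<and> card V = CARD('a) ^ (2 * n) \<and> nondegenerate_on V"

text \<open>Extending by \<open>0\<close> outside \<open>V\<close> makes the functions in \<open>sqzero V\<close> determined by their
  restriction to \<open>V\<close>, so that they can be counted.\<close>

definition sqzero :: "'v set \<Rightarrow> ('v \<Rightarrow> 'v) set" where
  "sqzero V = {N. (\<forall>x. x \<notin> V \<longrightarrow> N x = 0) \<and> (\<forall>x\<in>V. N x \<in> V \<and> N (N x) = 0) \<and>
     (\<forall>x\<in>V. \<forall>y\<in>V. N (x + y) = N x + N y \<and> B (N x) y = B x (N y)) \<and>
     (\<forall>c. \<forall>x\<in>V. N (c \<star> x) = c \<star> N x)}"

definition kernel_on :: "'v set \<Rightarrow> ('v \<Rightarrow> 'v) \<Rightarrow> 'v set" where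
  "kernel_on V N = {x\<in>V. N x = 0}"

lemma sqzeroI:
  assumes "\<And>x. x \<notin> V \<Longrightarrow> N x = 0" "\<And>x. x \<in> V \<Longrightarrow> N x \<in> V" "\<And>x. x \<in> V \<Longrightarrow> N (N x) = 0"
    "\<And>x y. x \<in> V \<Longrightarrow> y \<in> V \<Longrightarrow> N (x + y) = N x + N y"
    "\<And>x y. x \<in> V \<Longrightarrow> y \<in> V \<Longrightarrow> B (N x) y = B x (N y)"
    "\<And>c x. x \<in> V \<Longrightarrow> N (c \<star> x) = c \<star> N x"
  shows "N \<in> sqzero V"
  using assms by (auto simp: sqzero_def)

lemma sqzeroD:
  assumes "N \<in> sqzero V"
  shows "x \<notin> V \<Longrightarrow> N x = 0" "x \<in> V \<Longrightarrow> N x \<in> V" "x \<in> V \<Longrightarrow> N (N x) = 0"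
    "x \<in> V \<Longrightarrow> y \<in> V \<Longrightarrow> N (x + y) = N x + N y"
    "x \<in> V \<Longrightarrow> y \<in> V \<Longrightarrow> B (N x) y = B x (N y)"
    "x \<in> V \<Longrightarrow> N (c \<star> x) = c \<star> N x"
  using assms by (auto simp: sqzero_def)

lemma sqzero_0: "N \<in> sqzero V \<Longrightarrow> subspace V \<Longrightarrow> N 0 = 0"
  using sqzeroD(6)[of N V 0 0] subspace_0 by simp

lemma finite_sqzero:
  assumes "finite V"
  shows "finite (sqzero V)"
proof -
  have "finite {N. \<forall>x. (x \<in> V \<longrightarrow> N x \<in> V) \<and> (x \<notin> V \<longrightarrow> N x = 0)}"
    using assms assms by (rule finite_set_of_finite_funs)
  then show ?thesis by (rule finite_subset[rotated]) (auto simp: sqzero_def)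
qed

lemma symplectic_spaceD:
  assumes "symplectic_space n V"
  shows "subspace V" "card V = CARD('a) ^ (2 * n)" "nondegenerate_on V" "finite V"
proof -
  show "subspace V" "card V = CARD('a) ^ (2 * n)" "nondegenerate_on V"
    using assms by (auto simp: symplectic_space_def)
  then show "finite V" by (intro card_ge_0_finite) simp
qed

section \<open>Orthogonal splitting along a self-adjoint projection\<close>

text \<open>A square-zero map \<open>N\<close> is determined on the nondegenerate summand \<open>range p\<close> (where \<open>p\<close> is a
  self-adjoint projection) by the prescribed \<open>N0\<close>; what remains is its restriction to the orthogonal
  complement \<open>W\<close>.\<close>

context
  fixes V W :: "'v set" and p N0 :: "'v \<Rightarrow> 'v"
  assumes V: "subspace V" "finite V" "nondegenerate_on V"
    and p: "\<And>x y. p (x + y) = p x + p y" "\<And>c x. p (c \<star> x) = c \<star> p x"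
      "\<And>x. p (p x) = p x" "\<And>x y. B (p x) y = B x (p y)" "\<And>x. p x \<in> V"
    and N0: "\<And>x y. N0 (x + y) = N0 x + N0 y" "\<And>c x. N0 (c \<star> x) = c \<star> N0 x"
      "\<And>x. N0 (N0 x) = 0" "\<And>x y. B (N0 x) y = B x (N0 y)"
      "\<And>x. p (N0 x) = N0 x" "\<And>x. N0 (p x) = N0 x"
  defines "W \<equiv> {x\<in>V. p x = 0}"
begin

lemma split_simps [simp]:
  "p (p x) = p x" "p 0 = 0" "N0 0 = 0" "N0 (N0 x) = 0" "p (N0 x) = N0 x" "N0 (p x) = N0 x"
  "x \<in> V \<Longrightarrow> y \<in> V \<Longrightarrow> x + y \<in> V" "x \<in> V \<Longrightarrow> c \<star> x \<in> V" "p x \<in> V" "N0 x \<in> V"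
  using p N0 p(2)[of 0 0] N0(2)[of 0 0] p(5)[of "N0 x"] V(1) by (auto simp: subspace_add subspace_scale)

text \<open>In characteristic 2 \<open>x + p x\<close> is \<open>x - p x\<close>, the component of
  \<open>x\<close> in the complement of \<open>range p\<close>.\<close>

lemma split_W [simp]: "x \<in> W \<Longrightarrow> x \<in> V" "x \<in> W \<Longrightarrow> p x = 0" "x \<in> V \<Longrightarrow> x + p x \<in> W"
  by (auto simp: W_def p)

lemma split_N0_W [simp]: "x \<in> W \<Longrightarrow> N0 x = 0"
  using N0(6)[of x] by simp

lemma subspace_W: "subspace W"
  using subspace_0[OF V(1)] by (auto simp: W_def p simp del: split_W intro!: subspaceI)

lemma split_B [simp]: "x \<in> W \<Longrightarrow> B x (p y) = 0" "x \<in> W \<Longrightarrow> B (p y) x = 0"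
  using p(4)[of x y] p(4)[of y x] by auto

lemma split_decomp [simp]: "p x + (x + p x) = x"
  by (simp add: add.left_commute)

text \<open>\<open>W\<close> is orthogonal to \<open>range p\<close> and together they span
  \<open>V\<close>, so a vector of \<open>W\<close> orthogonal to \<open>W\<close> is orthogonal to
  all of \<open>V\<close>.\<close>

lemma nondegenerate_on_W: "nondegenerate_on W"
  unfolding nondegenerate_on_def
proof safe
  fix x assume x: "x \<in> W" and z: "\<forall>y\<in>W. B x y = 0"
  have "B x y = 0" if "y \<in> V" for y
    using z[rule_format, of "y + p y"] x that by (simp add: B_simps)
  then show "x = 0" using V(3) x by (auto simp: nondegenerate_on_def)
qed

lemma split_pair: "p a = a \<Longrightarrow> b \<in> W \<Longrightarrow> p (a + b) = a \<and> (a + b) + p (a + b) = b"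
  by (simp add: p(1) add.commute[of a b] add.assoc)

lemma card_split: "card V = card (range p) * card W"
proof -
  have "bij_betw (\<lambda>(a, b). a + b) (range p \<times> W) V"
    by (rule bij_betw_byWitness[where f' = "\<lambda>x. (p x, x + p x)"])
       (use split_pair in auto)
  from bij_betw_same_card[OF this] show ?thesis by (simp add: card_cartesian_product)
qed

text \<open>\<open>N\<close> preserves \<open>W\<close>: for \<open>y\<close> in \<open>W\<close>,
  self-adjointness turns the pairing of \<open>p (N y)\<close> with \<open>v\<close> into that of
  \<open>y\<close> with \<open>N (p v) = N0 v\<close>. The latter lies in \<open>range p\<close>,
  hence is orthogonal to \<open>y\<close>, and nondegeneracy gives
  \<open>p (N y) = 0\<close>.\<close>

lemma split_restrict:
  assumes N: "N \<in> sqzero V" and eq: "\<And>x. N (p x) = N0 x" and x: "x \<in> V"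
  shows "N x = N0 x + N (x + p x)" "p (N (x + p x)) = 0"
proof -
  have "N x = N (p x + (x + p x))" by simp
  also have "\<dots> = N0 x + N (x + p x)"
    using x eq by (subst sqzeroD(4)[OF N]) auto
  finally show 1: "N x = N0 x + N (x + p x)" .
  let ?y = "x + p x"
  have y: "?y \<in> W" using x by simp
  have "B (p (N ?y)) v = 0" if "v \<in> V" for v
  proof -
    have "B (p (N ?y)) v = B (N ?y) (p v)" by (rule p)
    also have "\<dots> = B ?y (N (p v))" using y that by (intro sqzeroD(5)[OF N]) auto
    also have "\<dots> = B ?y (p (N0 v))" using eq by simp
    also have "\<dots> = 0" using y by (simp del: split_simps)
    finally show ?thesis .
  qed
  then show "p (N (x + p x)) = 0"
    using V(3) by (auto simp: nondegenerate_on_def)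
qed

lemma kernel_split:
  assumes N: "N \<in> sqzero V" and eq: "\<And>x. N (p x) = N0 x"
  shows "card (kernel_on V N) =
    card {x. p x = x \<and> N0 x = 0} * card (kernel_on W (\<lambda>x. if x \<in> W then N x else 0))"
proof -
  let ?W = "kernel_on W (\<lambda>x. if x \<in> W then N x else 0)" and ?P = "{x. p x = x \<and> N0 x = 0}"
  have "bij_betw (\<lambda>(a, b). a + b) (?P \<times> ?W) (kernel_on V N)"
  proof (rule bij_betw_byWitness[where f' = "\<lambda>x. (p x, x + p x)"])
    show "\<forall>a\<in>?P \<times> ?W. (\<lambda>x. (p x, x + p x)) (case a of (a, b) \<Rightarrow> a + b) = a"
      using split_pair by (auto simp: kernel_on_def)
    show "\<forall>x\<in>kernel_on V N. (case (p x, x + p x) of (a, b) \<Rightarrow> a + b) = x"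
      by simp
    have "N (a + b) = 0 \<and> a + b \<in> V" if ab: "p a = a" "N0 a = 0" "b \<in> W" "N b = 0" for a b
    proof -
      have a: "a \<in> V" "N a = 0" using ab p(5)[of a] eq[of a] by auto
      then show ?thesis using sqzeroD(4)[OF N a(1), of b] ab by auto
    qed
    then show "(\<lambda>(a, b). a + b) ` (?P \<times> ?W) \<subseteq> kernel_on V N"
      by (auto simp: kernel_on_def split: if_splits)
    have "N0 x = 0 \<and> N (x + p x) = 0" if x: "x \<in> V" "N x = 0" for x
    proof -
      have e: "N0 x + N (x + p x) = 0" using split_restrict(1)[OF N eq x(1)] x by simp
      \<comment> \<open>Applying \<open>p\<close> separates the two summands: it fixes
        \<open>N0 x\<close> and kills the component in \<open>W\<close>.\<close>
      have "p (N0 x + N (x + p x)) = N0 x"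
        unfolding p(1) using split_restrict(2)[OF N eq x(1)] by simp
      then have "N0 x = 0" using e by simp
      then show ?thesis using e by simp
    qed
    then show "(\<lambda>x. (p x, x + p x)) ` kernel_on V N \<subseteq> ?P \<times> ?W"
      by (auto simp: kernel_on_def)
  qed
  from bij_betw_same_card[OF this] show ?thesis by (simp add: card_cartesian_product)
qed

text \<open>The inverse glues \<open>N0\<close> on \<open>range p\<close> to an arbitrary map in
  \<open>sqzero W\<close>. The glued map is again square-zero and self-adjoint because both pieces
  preserve their summands and these are orthogonal.\<close>

lemma bij_betw_split:
  "bij_betw (\<lambda>N x. if x \<in> W then N x else 0) {N \<in> sqzero V. \<forall>x. N (p x) = N0 x} (sqzero W)"
proof (rule bij_betw_byWitness[where f' = "\<lambda>N x. if x \<in> V then N0 x + N (x + p x) else 0"])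
  let ?F = "\<lambda>N x. if x \<in> W then N x else (0::'v)"
  let ?G = "\<lambda>N x. if x \<in> V then N0 x + N (x + p x) else (0::'v)"
  let ?S = "{N \<in> sqzero V. \<forall>x. N (p x) = N0 x}"
  show "\<forall>N\<in>?S. ?G (?F N) = N"
  proof safe
    fix N assume N: "N \<in> sqzero V" "\<forall>x. N (p x) = N0 x"
    show "?G (?F N) = N"
    proof
      fix x show "?G (?F N) x = N x"
        using sqzeroD(1)[OF N(1), of x] split_restrict(1)[OF N(1), of x] N(2) by (cases "x \<in> V") auto
    qed
  qed
  show "\<forall>N\<in>sqzero W. ?F (?G N) = N"
  proof safe
    fix N assume N: "N \<in> sqzero W"
    show "?F (?G N) = N"
    proof
      fix x show "?F (?G N) x = N x"
        using sqzeroD(1)[OF N, of x] by (cases "x \<in> W") auto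
    qed
  qed
  show "?F ` ?S \<subseteq> sqzero W"
  proof safe
    fix N assume N: "N \<in> sqzero V" "\<forall>x. N (p x) = N0 x"
    have NW: "N x \<in> W" if "x \<in> W" for x
      using split_restrict(2)[OF N(1), of x] N(2) that sqzeroD(2)[OF N(1), of x]
      by (auto simp: W_def simp del: split_W)
    show "?F N \<in> sqzero W"
    proof (rule sqzeroI)
      fix x y c assume x: "x \<in> W"
      have xV: "x \<in> V" using x by (rule split_W)
      show "?F N x \<in> W" using x NW[OF x] by simp
      show "?F N (?F N x) = 0" using x NW[OF x] sqzeroD(3)[OF N(1) xV] by simp
      show "?F N (c \<star> x) = c \<star> ?F N x"
        using x subspace_scale[OF subspace_W x] sqzeroD(6)[OF N(1) xV] by simp
      assume y: "y \<in> W"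
      have yV: "y \<in> V" using y by (rule split_W)
      show "?F N (x + y) = ?F N x + ?F N y"
        using x y subspace_add[OF subspace_W x y] sqzeroD(4)[OF N(1) xV yV] by simp
      show "B (?F N x) y = B x (?F N y)"
        using x y sqzeroD(5)[OF N(1) xV yV] by simp
    qed simp
  qed
  show "?G ` sqzero W \<subseteq> ?S"
  proof safe
    fix N x assume N: "N \<in> sqzero W"
    have NW: "N x \<in> W" if "x \<in> W" for x using sqzeroD(2)[OF N that] .
    have N00: "N 0 = 0" using sqzero_0[OF N subspace_W] .
    show "?G N (p x) = N0 x"
      by (simp add: N00)
    show "?G N \<in> sqzero V"
    proof (rule sqzeroI)
      fix x y assume xy: "x \<in> V" "y \<in> V"
      let ?x = "x + p x" and ?y = "y + p y"
      have X: "?x \<in> W" "?y \<in> W" using xy by auto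
      have "N ((x + y) + p (x + y)) = N (?x + ?y)"
        by (simp add: p add_ac)
      also have "\<dots> = N ?x + N ?y" by (rule sqzeroD(4)[OF N X])
      finally show "?G N (x + y) = ?G N x + ?G N y"
        using xy by (simp add: N0 add_ac)
      \<comment> \<open>Cross terms vanish since \<open>N ?x\<close> lies in \<open>W\<close> and
        \<open>p y\<close> in the orthogonal summand, so self-adjointness on \<open>W\<close>
        carries over to \<open>V\<close>.\<close>
      have "B (N ?x) y = B (N ?x) (p y + ?y)" by simp
      also have "\<dots> = B (N ?x) ?y" using NW[OF X(1)] unfolding B_add_right[of _ "p y"] by simp
      also have "\<dots> = B ?x (N ?y)" by (rule sqzeroD(5)[OF N X])
      also have "\<dots> = B (p x + ?x) (N ?y)"
        using NW[OF X(2)] unfolding B_add_left[of "p x" ?x] by simp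
      also have "\<dots> = B x (N ?y)" by simp
      finally show "B (?G N x) y = B x (?G N y)"
        using xy by (simp add: B_simps(1,2) N0(4))
    next
      fix x assume x: "x \<in> V"
      then have W: "N (x + p x) \<in> W" by (intro NW) auto
      then show "?G N x \<in> V" using x by auto
      let ?z = "N0 x + N (x + p x)"
      have eqs: "?z + p ?z = N (x + p x)" "N0 ?z = 0"
        using W by (simp_all add: p N0 add_ac)
      have "N0 ?z + N (?z + p ?z) = 0"
        unfolding eqs using x sqzeroD(3)[OF N, of "x + p x"] by simp
      moreover have "?z \<in> V" using x W by auto
      ultimately show "?G N (?G N x) = 0" using x by (simp only: if_True)
      fix c
      have "N (c \<star> x + c \<star> p x) = c \<star> N (x + p x)"
        using sqzeroD(6)[OF N, of "x + p x" c] x by (simp add: scale_right_distrib)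
      then show "?G N (c \<star> x) = c \<star> ?G N x"
        using x by (simp add: p N0 scale_right_distrib)
    qed auto
  qed
qed

text \<open>The same \<open>k\<close> is half the dimension of \<open>range p\<close> and the
  nullity of \<open>N0\<close> on it. Hence the kernel dimension minus half the dimension of the
  space, which is the parameter \<open>j\<close> of the count, agrees for \<open>V\<close> and
  \<open>W\<close>.\<close>

lemma symplectic_split:
  assumes n: "symplectic_space n V" and cp: "card (range p) = CARD('a) ^ (2 * k)"
    and cN: "card {x. p x = x \<and> N0 x = 0} = CARD('a) ^ k"
  shows "\<exists>m W F. n = m + k \<and> symplectic_space m W \<and>
    bij_betw F {N \<in> sqzero V. \<forall>x. N (p x) = N0 x} (sqzero W) \<and>
    (\<forall>N\<in>sqzero V. (\<forall>x. N (p x) = N0 x) \<longrightarrow>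
      card (kernel_on V N) = CARD('a) ^ k * card (kernel_on W (F N)))"
proof -
  let ?q = "CARD('a)"
  have q: "?q > 1" by (rule card_field_gt_1)
  have e: "?q ^ (2 * n) = ?q ^ (2 * k) * card W"
    using card_split symplectic_spaceD(2)[OF n] cp by simp
  have le: "k \<le> n" and "card W = ?q ^ (2 * (n - k))"
    using power_eq_power_mult[OF q e] by auto
  then have "symplectic_space (n - k) W"
    using subspace_W nondegenerate_on_W by (simp add: symplectic_space_def)
  moreover have "n = (n - k) + k" using le by simp
  moreover have "\<forall>N\<in>sqzero V. (\<forall>x. N (p x) = N0 x) \<longrightarrow> card (kernel_on V N) =
      ?q ^ k * card (kernel_on W (\<lambda>x. if x \<in> W then N x else 0))"
    using kernel_split unfolding cN by blast
  ultimately show ?thesis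
    using bij_betw_split by blast
qed

end

declare split_simps [simp del] split_W [simp del] split_N0_W [simp del] split_B [simp del]
  split_decomp [simp del]

section \<open>Level sets, and the two kinds of summand\<close>

lemma card_level:
  assumes U: "subspace U" and f: "f \<in> U" "B f y \<noteq> 0"
  shows "card U = card {x\<in>U. B x y = c} * CARD('a)"
proof -
  \<comment> \<open>\<open>?t u\<close> is the unique coefficient for which adding that multiple of
    \<open>f\<close> moves \<open>u\<close> to level \<open>c\<close>, so \<open>U\<close> is the
    product of one level set and the field.\<close>
  let ?t = "\<lambda>u. (B u y + c) / B f y"
  have "bij_betw (\<lambda>(x, t). x + t \<star> f) ({x\<in>U. B x y = c} \<times> UNIV) U"
    by (rule bij_betw_byWitness[where f' = "\<lambda>u. (u + ?t u \<star> f, ?t u)"])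
       (use f subspace_add[OF U] subspace_scale[OF U] in \<open>auto simp: B_simps add_ac\<close>)
  from bij_betw_same_card[OF this] show ?thesis by (simp add: card_cartesian_product)
qed

lemma symplectic_split_plane:
  assumes n: "symplectic_space n V" and ew: "e \<in> V" "w \<in> V" "B w e \<noteq> 0"
  shows "\<exists>m W F. n = m + 1 \<and> symplectic_space m W \<and>
    bij_betw F {N \<in> sqzero V. N e = w} (sqzero W) \<and>
    (\<forall>N\<in>sqzero V. N e = w \<longrightarrow> card (kernel_on V N) = CARD('a) * card (kernel_on W (F N)))"
proof -
  note V = symplectic_spaceD(1,4,3)[OF n]
  define c where "c = B w e"
  have c: "B w e = c" "B e w = c" "c \<noteq> 0" using ew B_sym[of e w] by (auto simp: c_def)
  have w0: "w \<noteq> 0" using c by auto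
  \<comment> \<open>\<open>p\<close> is the orthogonal projection onto the plane of \<open>e\<close>
    and \<open>w\<close>: each coefficient is read off by pairing with the other vector.
    \<open>N0\<close> sends \<open>e\<close> to \<open>w\<close> and \<open>w\<close> to
    \<open>0\<close>.\<close>
  define p where "p x = (B x w / c) \<star> e + (B x e / c) \<star> w" for x
  define N0 where "N0 x = (B x w / c) \<star> w" for x
  have pp: "p (p x) = p x" for x by (simp add: p_def B_simps c)
  have p_e: "p (a \<star> e + b \<star> w) = a \<star> e + b \<star> w" for a b by (simp add: p_def B_simps c)
  have pV: "p x \<in> V" for x by (simp add: p_def ew V(1) subspace_add subspace_scale)
  have p_adj: "B (p x) y = B x (p y)" for x y
    using B_sym[of e y] B_sym[of w y] by (simp add: p_def B_simps algebra_simps)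
  have N0_adj: "B (N0 x) y = B x (N0 y)" for x y
    using B_sym[of w y] by (simp add: N0_def B_simps algebra_simps)
  have "bij_betw (\<lambda>(a, b). a \<star> e + b \<star> w) UNIV (range p)"
    by (rule bij_betw_byWitness[where f' = "\<lambda>x. (B x w / c, B x e / c)"])
       (auto simp: B_simps c pp simp flip: p_def intro: image_eqI[where f=p, OF p_e[symmetric]])
  from bij_betw_same_card[OF this] have cp: "card (range p) = CARD('a) ^ (2 * 1)"
    by (simp add: power2_eq_square)
  have "bij_betw (\<lambda>b. b \<star> w) UNIV {x. p x = x \<and> N0 x = 0}"
  proof (rule bij_betw_byWitness[where f' = "\<lambda>x. B x e / c"])
    show "\<forall>x\<in>{x. p x = x \<and> N0 x = 0}. (B x e / c) \<star> w = x"
      by (auto simp: N0_def p_def w0 c)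
  qed (auto simp: B_simps c N0_def p_def)
  from bij_betw_same_card[OF this] have cN: "card {x. p x = x \<and> N0 x = 0} = CARD('a) ^ 1"
    by simp
  have eq: "(\<forall>x. N (p x) = N0 x) \<longleftrightarrow> N e = w" if N: "N \<in> sqzero V" for N
  proof
    assume *: "\<forall>x. N (p x) = N0 x"
    have "p e = e" "N0 e = w" using p_e[of 1 0] c by (simp_all add: N0_def)
    then show "N e = w" using * by metis
  next
    assume *: "N e = w"
    \<comment> \<open>The value at \<open>e\<close> determines \<open>N\<close> on the whole plane,
      because \<open>N w = N (N e)\<close>.\<close>
    then have "N w = 0" using sqzeroD(3)[OF N ew(1)] by simp
    then show "\<forall>x. N (p x) = N0 x"
      using * ew V(1) by (simp add: p_def N0_def sqzeroD(4,6)[OF N] subspace_scale)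
  qed
  have "\<exists>m W F. n = m + 1 \<and> symplectic_space m W \<and>
    bij_betw F {N \<in> sqzero V. \<forall>x. N (p x) = N0 x} (sqzero W) \<and>
    (\<forall>N\<in>sqzero V. (\<forall>x. N (p x) = N0 x) \<longrightarrow>
      card (kernel_on V N) = CARD('a) ^ 1 * card (kernel_on W (F N)))"
    by (rule symplectic_split[OF V _ _ pp p_adj pV _ _ _ N0_adj _ _ n cp cN])
       (auto simp: p_def N0_def B_simps c scale_left_distrib scale_right_distrib add_ac add_divide_distrib)
  then show ?thesis by (simp add: eq cong: conj_cong)
qed

lemma symplectic_split_4:
  assumes n: "symplectic_space n V"
    and V4: "e \<in> V" "h \<in> V" "w \<in> V" "z \<in> V"
    and Bs: "B e w = 0" "B e h = 0" "B w h = 1" "B z w = 0" "B z e = 1"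
  shows "\<exists>m W F. n = m + 2 \<and> symplectic_space m W \<and>
    bij_betw F {N \<in> sqzero V. N e = w \<and> N h = z} (sqzero W) \<and>
    (\<forall>N\<in>sqzero V. N e = w \<and> N h = z \<longrightarrow>
      card (kernel_on V N) = CARD('a) ^ 2 * card (kernel_on W (F N)))"
proof -
  note V = symplectic_spaceD(1,4,3)[OF n]
  define d where "d = B h z"
  have c: "B w e = 0" "B h e = 0" "B h w = 1" "B w z = 0" "B e z = 1" "B h z = d" "B z h = d"
    using Bs B_sym by (auto simp: d_def)
  note c = c Bs
  \<comment> \<open>The only nonzero pairings among \<open>e\<close>, \<open>h\<close>,
    \<open>w\<close>, \<open>z\<close> are \<open>B e z = B h w = 1\<close> and possibly
    \<open>B h z = d\<close>. Solving for the coordinates of \<open>x\<close> gives these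
    coefficients; the terms with \<open>d\<close> correct for \<open>B h z\<close>.
    \<open>N0\<close> sends \<open>e\<close> to \<open>w\<close>, \<open>h\<close> to
    \<open>z\<close>, and \<open>w\<close>, \<open>z\<close> to \<open>0\<close>.\<close>
  define p where "p x = (B x z + d * B x w) \<star> e + (B x w \<star> h +
    ((B x h + d * B x e) \<star> w + B x e \<star> z))" for x
  define N0 where "N0 x = (B x z + d * B x w) \<star> w + B x w \<star> z" for x
  have pe: "p (a \<star> e + (b \<star> h + (a' \<star> w + b' \<star> z))) =
      a \<star> e + (b \<star> h + (a' \<star> w + b' \<star> z))" for a b a' b'
    by (simp add: p_def B_simps c algebra_simps)
  have pp: "p (p x) = p x" for x
    using pe by (simp add: p_def[of x])
  have pV: "p x \<in> V" for x by (simp add: p_def V4 V(1) subspace_add subspace_scale)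
  have p_adj: "B (p x) y = B x (p y)" for x y
    using B_sym[of e y] B_sym[of w y] B_sym[of h y] B_sym[of z y]
    by (simp add: p_def B_simps algebra_simps)
  have N0_adj: "B (N0 x) y = B x (N0 y)" for x y
    using B_sym[of w y] B_sym[of z y] by (simp add: N0_def B_simps algebra_simps)
  have "bij_betw (\<lambda>((a, b), (a', b')). a \<star> e + (b \<star> h + (a' \<star> w + b' \<star> z))) UNIV (range p)"
  proof (rule bij_betw_byWitness[where f' =
            "\<lambda>x. ((B x z + d * B x w, B x w), (B x h + d * B x e, B x e))"], goal_cases)
    case 1
    show ?case by (auto simp: B_simps c algebra_simps)
  next
    case 2
    show ?case by (auto simp: pp simp flip: p_def)
  next
    case 3
    show ?case by (auto intro: image_eqI[where f=p, OF pe[symmetric]])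
  qed auto
  from bij_betw_same_card[OF this] have cp: "card (range p) = CARD('a) ^ (2 * 2)"
    by (simp add: power_numeral_reduce)
  \<comment> \<open>Pairing with \<open>e\<close> isolates \<open>b\<close>, and then pairing with
    \<open>h\<close> isolates \<open>a\<close>.\<close>
  have wz: "a = 0 \<and> b = 0" if "a \<star> w + b \<star> z = 0" for a b
    using arg_cong[OF that, of "\<lambda>x. B x e"] arg_cong[OF that, of "\<lambda>x. B x h"]
    by (auto simp: B_simps c)
  have "bij_betw (\<lambda>(a, b). a \<star> w + b \<star> z) UNIV {x. p x = x \<and> N0 x = 0}"
  proof (rule bij_betw_byWitness[where f' = "\<lambda>x. (B x h + d * B x e, B x e)"])
    show "\<forall>x\<in>{x. p x = x \<and> N0 x = 0}.
        (case (B x h + d * B x e, B x e) of (a, b) \<Rightarrow> a \<star> w + b \<star> z) = x"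
    proof safe
      fix x assume x: "p x = x" "N0 x = 0"
      have "B x z + d * B x w = 0 \<and> B x w = 0"
        by (rule wz) (use x in \<open>simp add: N0_def\<close>)
      then have "B x w = 0" "B x z = 0" by auto
      then have "p x = (B x h + d * B x e) \<star> w + B x e \<star> z" by (simp add: p_def)
      then show "(B x h + d * B x e) \<star> w + B x e \<star> z = x" using x by simp
    qed
  qed (auto simp: B_simps c N0_def p_def algebra_simps)
  from bij_betw_same_card[OF this] have cN: "card {x. p x = x \<and> N0 x = 0} = CARD('a) ^ 2"
    by (simp add: power2_eq_square)
  have eq: "(\<forall>x. N (p x) = N0 x) \<longleftrightarrow> N e = w \<and> N h = z" if N: "N \<in> sqzero V" for N
  proof
    assume *: "\<forall>x. N (p x) = N0 x"
    have "p e = e" "N0 e = w" "p h = h" "N0 h = z"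
      using pe[of 1 0 0 0] pe[of 0 1 0 0] c by (simp_all add: N0_def)
    then show "N e = w \<and> N h = z" using * by metis
  next
    assume *: "N e = w \<and> N h = z"
    then have "N w = 0" "N z = 0"
      using sqzeroD(3)[OF N V4(1)] sqzeroD(3)[OF N V4(2)] by auto
    then show "\<forall>x. N (p x) = N0 x"
      using * V4 V(1) by (simp add: p_def N0_def sqzeroD(4,6)[OF N] subspace_scale subspace_add)
  qed
  have "\<exists>m W F. n = m + 2 \<and> symplectic_space m W \<and>
    bij_betw F {N \<in> sqzero V. \<forall>x. N (p x) = N0 x} (sqzero W) \<and>
    (\<forall>N\<in>sqzero V. (\<forall>x. N (p x) = N0 x) \<longrightarrow>
      card (kernel_on V N) = CARD('a) ^ 2 * card (kernel_on W (F N)))"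
    by (rule symplectic_split[OF V _ _ pp p_adj pV _ _ _ N0_adj _ _ n cp cN])
       (auto simp: p_def N0_def B_simps c algebra_simps)
  then show ?thesis by (simp add: eq cong: conj_cong)
qed

text \<open>Otherwise, after rescaling, the functional \<open>B w\<close> vanishes on the hyperplane
  orthogonal to \<open>e\<close>, so it is a multiple of \<open>B e\<close>; by nondegeneracy
  \<open>w\<close> is then a multiple of \<open>e\<close>.\<close>

lemma dual_vector:
  assumes n: "symplectic_space n V" and ew: "e \<in> V" "w \<in> V" and e0: "e \<noteq> 0"
    and w: "\<And>a. w \<noteq> a \<star> e"
  shows "\<exists>h\<in>V. B e h = 0 \<and> B w h = 1"
proof (rule ccontr)
  assume contra: "\<not> ?thesis"
  note V = symplectic_spaceD(1,4,3)[OF n]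
  have z: "B w h = 0" if "h \<in> V" "B e h = 0" for h
  proof (rule ccontr)
    assume "B w h \<noteq> 0"
    then have "B e (inverse (B w h) \<star> h) = 0 \<and> B w (inverse (B w h) \<star> h) = 1"
      using that by (simp add: B_simps)
    then show False using contra that subspace_scale[OF V(1)] by blast
  qed
  obtain f where f: "f \<in> V" "B e f \<noteq> 0" using V(3) e0 ew by (auto simp: nondegenerate_on_def)
  \<comment> \<open>This coefficient makes \<open>w + ?a \<star> e\<close> orthogonal to
    \<open>f\<close> as well, and \<open>f\<close> together with the hyperplane orthogonal to
    \<open>e\<close> spans \<open>V\<close>.\<close>
  let ?a = "B w f / B e f"
  have "B (w + ?a \<star> e) y = 0" if y: "y \<in> V" for y
  proof -
    have "B w (y + (B e y / B e f) \<star> f) = 0"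
      using y f by (intro z) (auto simp: B_simps intro!: subspace_add[OF V(1)] subspace_scale[OF V(1)])
    then show ?thesis by (simp add: B_simps mult.commute)
  qed
  moreover have "w + ?a \<star> e \<in> V" using ew V(1) by (simp add: subspace_add subspace_scale)
  ultimately have "w + ?a \<star> e = 0" using V(3) by (auto simp: nondegenerate_on_def)
  then show False using w by (simp add: add_eq_0)
qed

text \<open>Each splitting keeps \<open>j\<close> and lowers \<open>n\<close>, and the descent ends
  at a zero map, where \<open>j = n\<close>.\<close>

lemma card_kernel_on_power:
  assumes "symplectic_space n V" "N \<in> sqzero V"
  shows "\<exists>j\<le>n. card (kernel_on V N) = CARD('a) ^ (n + j)"
  using assms
proof (induction n arbitrary: V N rule: less_induct)
  case (less n)
  note n = less.prems(1) and N = less.prems(2)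
  show ?case
  proof (cases "\<forall>e\<in>V. N e = 0")
    case True
    then have "kernel_on V N = V" by (auto simp: kernel_on_def)
    then have "card (kernel_on V N) = CARD('a) ^ (n + n)"
      using symplectic_spaceD(2)[OF n] by (simp add: mult_2)
    then show ?thesis by auto
  next
    case False
    then obtain e where e: "e \<in> V" "N e \<noteq> 0" by blast
    define w where "w = N e"
    have w: "w \<in> V" "w \<noteq> 0" "N w = 0"
      using e sqzeroD(2,3)[OF N e(1)] by (auto simp: w_def)
    show ?thesis
    proof (cases "B w e = 0")
      case False
      from symplectic_split_plane[OF n e(1) w(1) False] obtain m W F where
        m: "n = m + 1" "symplectic_space m W" and
        F: "bij_betw F {N \<in> sqzero V. N e = w} (sqzero W)"
          "\<forall>N\<in>sqzero V. N e = w \<longrightarrow> card (kernel_on V N) = CARD('a) * card (kernel_on W (F N))"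
        by blast
      have "F N \<in> sqzero W" using F(1) N by (auto simp: bij_betw_def w_def)
      with less.IH[of m W] m obtain j where "j \<le> m" "card (kernel_on W (F N)) = CARD('a) ^ (m + j)"
        by auto
      then show ?thesis using F(2) N m by (auto intro!: exI[of _ j] simp: w_def)
    next
      case True
      \<comment> \<open>A square-zero map has no nonzero eigenvalue: \<open>w = a \<star> e\<close>
        would give \<open>0 = N w = a \<star> w\<close>.\<close>
      have "w \<noteq> a \<star> e" for a
        using w e sqzeroD(6)[OF N e(1), of a] by (auto simp: w_def)
      then obtain h where h: "h \<in> V" "B e h = 0" "B w h = 1"
        using dual_vector[OF n e(1) w(1)] e sqzero_0[OF N] symplectic_spaceD(1)[OF n] by metis
      define z where "z = N h"
      \<comment> \<open>Self-adjointness forces these values: \<open>B z w = B h (N w) = 0\<close>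
        and \<open>B z e = B h (N e) = B h w = 1\<close>.\<close>
      have z: "z \<in> V" "B z w = 0" "B z e = 1"
        using sqzeroD(2)[OF N h(1)] sqzeroD(5)[OF N h(1) w(1)] sqzeroD(5)[OF N h(1) e(1)] w h B_sym[of h w]
        by (auto simp: z_def w_def[symmetric])
      have "B e w = 0" using True B_sym[of e w] by simp
      from symplectic_split_4[OF n e(1) h(1) w(1) z(1) this h(2,3) z(2,3)] obtain m W F where
        m: "n = m + 2" "symplectic_space m W" and
        F: "bij_betw F {N \<in> sqzero V. N e = w \<and> N h = z} (sqzero W)"
          "\<forall>N\<in>sqzero V. N e = w \<and> N h = z \<longrightarrow>
             card (kernel_on V N) = CARD('a) ^ 2 * card (kernel_on W (F N))"
        by blast
      have "F N \<in> sqzero W" using F(1) N by (auto simp: bij_betw_def w_def z_def)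
      with less.IH[of m W] m obtain j where "j \<le> m" "card (kernel_on W (F N)) = CARD('a) ^ (m + j)"
        by auto
      then show ?thesis using F(2) N m
        by (auto intro!: exI[of _ j] simp: w_def z_def power2_eq_square)
    qed
  qed
qed

subsection \<open>Counting by the dimension of the kernel\<close>

definition sqzero_ker :: "'v set \<Rightarrow> nat \<Rightarrow> ('v \<Rightarrow> 'v) set" where
  "sqzero_ker V k = {N \<in> sqzero V. card (kernel_on V N) = k}"

text \<open>\<open>P\<close> prescribes \<open>N\<close> on the summand split off, and
  \<open>r\<close> is the size of the kernel there.\<close>

lemma card_sqzero_ker_bij:
  assumes F: "bij_betw F {N \<in> sqzero V. P N} (sqzero W)"
    and ker: "\<forall>N\<in>sqzero V. P N \<longrightarrow> card (kernel_on V N) = r * card (kernel_on W (F N))" and r: "r > 0"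
  shows "card {N \<in> sqzero_ker V (r * k). P N} = card (sqzero_ker W k)"
proof (rule bij_betw_same_card)
  have "{N \<in> sqzero_ker V (r * k). P N} = {N \<in> {N \<in> sqzero V. P N}. card (kernel_on W (F N)) = k}"
    using ker r by (auto simp: sqzero_ker_def)
  moreover have "sqzero_ker W k = F ` {N \<in> {N \<in> sqzero V. P N}. card (kernel_on W (F N)) = k}"
    using F by (auto simp: sqzero_ker_def bij_betw_def)
  ultimately show "bij_betw F {N \<in> sqzero_ker V (r * k). P N} (sqzero_ker W k)"
    using F by (auto simp: bij_betw_def intro: inj_on_subset)
qed

text \<open>The maps are sorted by \<open>w = N e\<close>. The first factor counts the
  \<open>w\<close> not orthogonal to \<open>e\<close>, each splitting off a plane. The second counts
  the orthogonal \<open>w\<close> off the line of \<open>e\<close>; each of these leaves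
  \<open>q ^ (2 n - 2)\<close> values for \<open>N h\<close>, and a 4-space splits off. For
  \<open>n = 1\<close> the truncated \<open>n - 2\<close> is harmless, since the factor before it
  vanishes.\<close>

lemma card_sqzero_moving:
  assumes IH: "\<And>m W. m < n \<Longrightarrow> symplectic_space m W \<Longrightarrow>
      real (card (sqzero_ker W (CARD('a) ^ (m + j)))) = c m"
    and n: "symplectic_space n V" and e: "e \<in> V" "e \<noteq> 0"
  shows "real (card {N \<in> sqzero_ker V (CARD('a) ^ (n + j)). N e \<noteq> 0}) =
    (real CARD('a) ^ (2 * n) - real CARD('a) ^ (2 * n - 1)) * c (n - 1) +
    (real CARD('a) ^ (2 * n - 1) - real CARD('a)) * (real CARD('a) ^ (2 * n - 2) * c (n - 2))"
proof -
  let ?q = "CARD('a)"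
  have q: "?q > 1" by (rule card_field_gt_1)
  note V = symplectic_spaceD[OF n]
  have S: "finite (sqzero_ker V k)" for k
    using finite_sqzero[OF V(4)] by (simp add: sqzero_ker_def)
  obtain f where f: "f \<in> V" "B f e \<noteq> 0"
    using V(3) e B_sym by (metis nondegenerate_on_def)
  have n0: "n > 0"
  proof (rule gr0I)
    assume "n = 0"
    then have "card V = 1" using V(2) by simp
    then show False using e subspace_0[OF V(1)] by (auto simp: card_1_singleton_iff)
  qed
  then have pn: "?q ^ (2 * n) = ?q ^ (2 * n - 1) * ?q" by (simp flip: power_Suc2)
  have "2 * n - 1 = Suc (2 * n - 2)" using n0 by simp
  then have pn2: "?q ^ (2 * n - 1) = ?q ^ (2 * n - 2) * ?q" by (simp only: power_Suc2)
  have orth: "card {w\<in>V. B w e = 0} = ?q ^ (2 * n - 1)"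
    using card_level[OF V(1) f, of 0] q V(2) pn by simp
  have le1: "?q ^ (2 * n - 1) \<le> ?q ^ (2 * n)" using q by (intro power_increasing) auto
  have "?q ^ 1 \<le> ?q ^ (2 * n - 1)" using q n0 by (intro power_increasing) auto
  then have le2: "?q \<le> ?q ^ (2 * n - 1)" by simp
  define A where "A = {w\<in>V. B w e \<noteq> 0}"
  define D where "D = {w\<in>V. B w e = 0 \<and> w \<notin> range (\<lambda>a. a \<star> e)}"
  have "A = V - {w\<in>V. B w e = 0}" by (auto simp: A_def)
  then have cA: "real (card A) = real ?q ^ (2 * n) - real ?q ^ (2 * n - 1)"
    using card_Diff_subset[of "{w\<in>V. B w e = 0}" V] V(2,4) orth le1 by (simp add: of_nat_diff)
  have "inj (\<lambda>a. a \<star> e)" using e by (auto intro: injI)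
  then have "card (range (\<lambda>a. a \<star> e)) = ?q" by (rule card_image)
  moreover have "range (\<lambda>a. a \<star> e) \<subseteq> {w\<in>V. B w e = 0}"
    using e subspace_scale[OF V(1)] by (auto simp: B_simps)
  moreover have "D = {w\<in>V. B w e = 0} - range (\<lambda>a. a \<star> e)" by (auto simp: D_def)
  ultimately have "card D = ?q ^ (2 * n - 1) - ?q"
    using orth by (simp add: card_Diff_subset)
  then have cD: "real (card D) = real ?q ^ (2 * n - 1) - real ?q"
    using le2 by (simp add: of_nat_diff)
  let ?S = "sqzero_ker V (?q ^ (n + j))"
  have gA: "real (card {N\<in>?S. N e = w}) = c (n - 1)" if w: "w \<in> A" for w
  proof -
    have w: "w \<in> V" "B w e \<noteq> 0" using w by (auto simp: A_def)
    from symplectic_split_plane[OF n e(1) w] obtain m W F where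
        m: "n = m + 1" "symplectic_space m W" and
        F: "bij_betw F {N \<in> sqzero V. N e = w} (sqzero W)"
          "\<forall>N\<in>sqzero V. N e = w \<longrightarrow> card (kernel_on V N) = CARD('a) * card (kernel_on W (F N))"
      by blast
    show ?thesis
      using card_sqzero_ker_bij[OF F, of "?q ^ (m + j)"] IH[OF _ m(2)] m(1) by simp
  qed
  have gD: "real (card {N\<in>?S. N e = w}) = real ?q ^ (2 * n - 2) * c (n - 2)" if w: "w \<in> D" for w
  proof -
    have w: "w \<in> V" "B w e = 0" "\<And>a. w \<noteq> a \<star> e" using w by (auto simp: D_def)
    have ew: "B e w = 0" using w B_sym[of e w] by simp
    have w0: "w \<noteq> 0" using w(3)[of 0] by simp
    have e_w: "e \<noteq> a \<star> w" for a
    proof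
      assume a: "e = a \<star> w"
      then have "a \<noteq> 0" using e by auto
      then have "w = inverse a \<star> e" using a by simp
      then show False using w(3) by blast
    qed
    obtain h where h: "h \<in> V" "B e h = 0" "B w h = 1"
      using dual_vector[OF n e(1) w(1) e(2) w(3)] by blast
    \<comment> \<open>\<open>g\<close> has a nonzero pairing with \<open>e\<close> inside the
      hyperplane orthogonal to \<open>w\<close>, which makes the level sets of \<open>B z e\<close>
      in that hyperplane equally large.\<close>
    obtain g where g: "g \<in> V" "B w g = 0" "B e g = 1"
      using dual_vector[OF n w(1) e(1) w0 e_w] by blast
    \<comment> \<open>The candidates for \<open>N h\<close>: self-adjointness imposes exactly these
      two conditions, and each cuts the cardinality by a factor \<open>q\<close>.\<close>
    let ?Z = "{z \<in> {z\<in>V. B z w = 0}. B z e = 1}"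
    have "subspace {z\<in>V. B z w = 0}"
      using V(1) by (auto intro!: subspaceI simp: B_simps subspace_0 subspace_add subspace_scale)
    from card_level[OF this, of g e 1] have "card {z\<in>V. B z w = 0} = card ?Z * ?q"
      using g B_sym[of g] by simp
    moreover have "card V = card {z\<in>V. B z w = 0} * ?q"
      using card_level[OF V(1) h(1), of w 0] h B_sym[of h w] by simp
    ultimately have cZ: "card ?Z = ?q ^ (2 * n - 2)"
      using V(2) pn pn2 q by simp
    have gz: "real (card {N\<in>{N\<in>?S. N e = w}. N h = z}) = c (n - 2)" if z: "z \<in> ?Z" for z
    proof -
      have z: "z \<in> V" "B z w = 0" "B z e = 1" using z by auto
      from symplectic_split_4[OF n e(1) h(1) w(1) z(1) ew h(2,3) z(2,3)] obtain m W F where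
        m: "n = m + 2" "symplectic_space m W" and
        F: "bij_betw F {N \<in> sqzero V. N e = w \<and> N h = z} (sqzero W)"
          "\<forall>N\<in>sqzero V. N e = w \<and> N h = z \<longrightarrow>
             card (kernel_on V N) = CARD('a) ^ 2 * card (kernel_on W (F N))"
        by blast
      have "{N\<in>{N\<in>?S. N e = w}. N h = z} = {N\<in>?S. N e = w \<and> N h = z}" by auto
      then show ?thesis
        using card_sqzero_ker_bij[OF F, of "?q ^ (m + j)"] IH[OF _ m(2)] m(1)
        by (simp add: power2_eq_square mult.assoc)
    qed
    have "(\<lambda>N. N h) ` {N\<in>?S. N e = w} \<subseteq> ?Z"
    proof safe
      fix N assume N: "N \<in> ?S" and w_def: "w = N e"
      have N: "N \<in> sqzero V" using N by (simp add: sqzero_ker_def)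
      have "N w = 0" using sqzeroD(3)[OF N e(1)] by (simp add: w_def)
      then show "N h \<in> V" "B (N h) (N e) = 0" "B (N h) e = 1"
        using sqzeroD(2)[OF N h(1)] sqzeroD(5)[OF N h(1) w(1)] sqzeroD(5)[OF N h(1) e(1)] h B_sym[of h w]
        by (auto simp flip: w_def)
    qed
    then have "card {N\<in>?S. N e = w} = (\<Sum>z\<in>?Z. card {N\<in>{N\<in>?S. N e = w}. N h = z})"
      using V(4) S by (intro card_eq_sum_fibres) auto
    then have "real (card {N\<in>?S. N e = w}) =
        (\<Sum>z\<in>?Z. real (card {N\<in>{N\<in>?S. N e = w}. N h = z}))" by (simp only: of_nat_sum)
    also have "\<dots> = (\<Sum>z\<in>?Z. c (n - 2))" by (rule sum.cong[OF refl gz])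
    finally show ?thesis using cZ by simp
  qed
  have "(\<lambda>N. N e) ` {N\<in>?S. N e \<noteq> 0} \<subseteq> A \<union> D"
  proof safe
    fix N assume N: "N \<in> ?S" "N e \<noteq> 0" "N e \<notin> D"
    have NV: "N \<in> sqzero V" using N by (simp add: sqzero_ker_def)
    have "N e \<noteq> a \<star> e" for a
      using N sqzeroD(3,6)[OF NV e(1)] by auto
    then show "N e \<in> A" using N sqzeroD(2)[OF NV e(1)] by (auto simp: A_def D_def)
  qed
  then have "card {N\<in>?S. N e \<noteq> 0} = (\<Sum>w\<in>A\<union>D. card {N\<in>{N\<in>?S. N e \<noteq> 0}. N e = w})"
    using V(4) S by (intro card_eq_sum_fibres) (auto simp: A_def D_def)
  also have "\<dots> = (\<Sum>w\<in>A\<union>D. card {N\<in>?S. N e = w})"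
  proof (rule sum.cong[OF refl])
    fix w assume "w \<in> A \<union> D"
    then have "w \<noteq> 0" by (auto simp: A_def D_def intro: range_eqI[of _ _ 0])
    then have "{N\<in>{N\<in>?S. N e \<noteq> 0}. N e = w} = {N\<in>?S. N e = w}" by auto
    then show "card {N\<in>{N\<in>?S. N e \<noteq> 0}. N e = w} = card {N\<in>?S. N e = w}" by simp
  qed
  also have "\<dots> = (\<Sum>w\<in>A. card {N\<in>?S. N e = w}) + (\<Sum>w\<in>D. card {N\<in>?S. N e = w})"
    using V(4) by (intro sum.union_disjoint) (auto simp: A_def D_def)
  finally have "real (card {N\<in>?S. N e \<noteq> 0}) =
      (\<Sum>w\<in>A. real (card {N\<in>?S. N e = w})) + (\<Sum>w\<in>D. real (card {N\<in>?S. N e = w}))"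
    by (simp only: of_nat_sum of_nat_add)
  also have "\<dots> = card A * c (n - 1) + card D * (real ?q ^ (2 * n - 2) * c (n - 2))"
    using gA gD by simp
  finally show ?thesis by (simp only: cA cD)
qed

text \<open>Double counting of the pairs of a map \<open>N\<close> and a nonzero \<open>v\<close>
  with \<open>N v \<noteq> 0\<close>: each \<open>N\<close> moves
  \<open>q ^ (2 n) - q ^ (n + j)\<close> vectors, and the number of maps moving \<open>v\<close> is
  the same for every nonzero \<open>v\<close>.\<close>

lemma card_sqzero_ker_recurrence:
  assumes IH: "\<And>m W. m < n \<Longrightarrow> symplectic_space m W \<Longrightarrow>
      real (card (sqzero_ker W (CARD('a) ^ (m + j)))) = c m"
    and n: "symplectic_space n V"
  shows "real (card (sqzero_ker V (CARD('a) ^ (n + j)))) *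
      (real CARD('a) ^ (2 * n) - real CARD('a) ^ (n + j)) =
    (real CARD('a) ^ (2 * n) - 1) *
      ((real CARD('a) ^ (2 * n) - real CARD('a) ^ (2 * n - 1)) * c (n - 1) +
      (real CARD('a) ^ (2 * n - 1) - real CARD('a)) * (real CARD('a) ^ (2 * n - 2) * c (n - 2)))"
    (is "?L = ?q1 * ?R")
proof -
  note V = symplectic_spaceD[OF n]
  let ?S = "sqzero_ker V (CARD('a) ^ (n + j))"
  have S: "finite ?S" using finite_sqzero[OF V(4)] by (simp add: sqzero_ker_def)
  have "(\<Sum>N\<in>?S. real (card {v\<in>V - {0}. N v \<noteq> 0})) = (\<Sum>v\<in>V - {0}. real (card {N\<in>?S. N v \<noteq> 0}))"
    using sum.swap_restrict[OF S, of "V - {0}" "\<lambda>_ _. 1::real" "\<lambda>N v. N v \<noteq> 0"] V(4) by simp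
  also have "\<dots> = (\<Sum>v\<in>V - {0}. ?R)"
  proof (rule sum.cong[OF refl])
    fix v assume "v \<in> V - {0}"
    then have v: "v \<in> V" "v \<noteq> 0" by auto
    show "real (card {N\<in>?S. N v \<noteq> 0}) = ?R"
      by (rule card_sqzero_moving[OF _ n v]) (rule IH)
  qed
  also have "\<dots> = real (card (V - {0})) * ?R" by (simp only: sum_constant)
  also have "card (V - {0}) = CARD('a) ^ (2 * n) - 1"
    by (simp only: card_Diff_singleton[OF subspace_0[OF V(1)]] V(2))
  also have "real (CARD('a) ^ (2 * n) - 1) = ?q1"
    by (subst of_nat_diff) auto
  finally have "(\<Sum>N\<in>?S. real (card {v\<in>V - {0}. N v \<noteq> 0})) = ?q1 * ?R" .
  moreover have "real (card {v\<in>V - {0}. N v \<noteq> 0}) =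
      real CARD('a) ^ (2 * n) - real CARD('a) ^ (n + j)" if "N \<in> ?S" for N
  proof -
    have N: "N \<in> sqzero V" "card (kernel_on V N) = CARD('a) ^ (n + j)"
      using that by (auto simp: sqzero_ker_def)
    have "{v\<in>V - {0}. N v \<noteq> 0} = V - kernel_on V N"
      using sqzero_0[OF N(1) V(1)] by (auto simp: kernel_on_def)
    moreover have "kernel_on V N \<subseteq> V" by (auto simp: kernel_on_def)
    moreover from card_mono[OF V(4) this] have "CARD('a) ^ (n + j) \<le> CARD('a) ^ (2 * n)"
      using V(2) N(2) by simp
    ultimately show ?thesis
      using card_Diff_subset[of "kernel_on V N" V] finite_subset[OF _ V(4)] V(2) N(2)
      by (simp add: of_nat_diff)
  qed
  ultimately have "(\<Sum>N\<in>?S. real CARD('a) ^ (2 * n) - real CARD('a) ^ (n + j)) = ?q1 * ?R"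
    by (metis (no_types, lifting) sum.cong)
  then show ?thesis by (simp only: sum_constant)
qed

text \<open>At \<open>j = n\<close> the left factor of the recurrence is \<open>0\<close>, so this
  starting value is found directly: only the zero map has full kernel.\<close>

lemma sqzero_ker_top:
  assumes n: "symplectic_space n V"
  shows "card (sqzero_ker V (CARD('a) ^ (n + n))) = 1"
proof -
  note V = symplectic_spaceD[OF n]
  have "sqzero_ker V (CARD('a) ^ (n + n)) = {\<lambda>x. 0}"
  proof safe
    fix N assume "N \<in> sqzero_ker V (CARD('a) ^ (n + n))"
    then have N: "N \<in> sqzero V" "card (kernel_on V N) = card V"
      using V by (auto simp: sqzero_ker_def mult_2)
    then have "kernel_on V N = V"
      using V(4) by (intro card_subset_eq) (auto simp: kernel_on_def)
    then show "N = (\<lambda>x. 0)" using sqzeroD(1)[OF N(1)] by (fastforce simp: kernel_on_def)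
  next
    have "(\<lambda>x. 0) \<in> sqzero V" using subspace_0[OF V(1)] by (intro sqzeroI) auto
    moreover have "kernel_on V (\<lambda>x. 0) = V" by (auto simp: kernel_on_def)
    ultimately show "(\<lambda>x. 0) \<in> sqzero_ker V (CARD('a) ^ (n + n))"
      using V by (simp add: sqzero_ker_def mult_2)
  qed
  then show ?thesis by simp
qed

lemma card_sqzero_eq_sum:
  assumes n: "symplectic_space n V"
  shows "card (sqzero V) = (\<Sum>j\<le>n. card (sqzero_ker V (CARD('a) ^ (n + j))))"
proof -
  note V = symplectic_spaceD[OF n]
  let ?f = "\<lambda>j. CARD('a) ^ (n + j)"
  have inj: "inj_on ?f {..n}" using card_field_gt_1[where 'a = 'a] by (auto intro!: inj_onI)
  have "card (sqzero V) = (\<Sum>k\<in>?f ` {..n}. card {N\<in>sqzero V. card (kernel_on V N) = k})"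
    using finite_sqzero[OF V(4)] card_kernel_on_power[OF n]
    by (intro card_eq_sum_fibres) fastforce+
  then show ?thesis by (simp add: sum.reindex[OF inj] sqzero_ker_def)
qed

end

subsection \<open>The solution of the recurrence and its limit\<close>

text \<open>The q-Pochhammer symbol \<open>(x; x)_n\<close>, later used at
  \<open>x = 1 / q ^ 2\<close>.\<close>

definition qpoch :: "real \<Rightarrow> nat \<Rightarrow> real" where
  "qpoch x n = (\<Prod>i<n. 1 - x ^ Suc i)"

lemma qpoch_0 [simp]: "qpoch x 0 = 1"
  and qpoch_Suc: "qpoch x (Suc n) = qpoch x n * (1 - x ^ Suc n)"
  by (simp_all add: qpoch_def)

lemma qpoch_pos: "0 \<le> x \<Longrightarrow> x < 1 \<Longrightarrow> qpoch x n > 0"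
  unfolding qpoch_def by (intro prod_pos) (auto simp: power_less_one_iff simp del: power_Suc)

lemma qpoch_le_1: "0 \<le> x \<Longrightarrow> x < 1 \<Longrightarrow> qpoch x n \<le> 1"
  unfolding qpoch_def by (intro prod_le_1) (auto simp: power_le_one simp del: power_Suc)

text \<open>The Weierstrass inequality bounds the product below by one minus a geometric sum. The
  bound \<open>1 / 4\<close> on \<open>x\<close> is its value for \<open>q = 2\<close>, so the
  estimate is uniform in \<open>q\<close> and \<open>n\<close>.\<close>

lemma qpoch_ge_half:
  assumes "0 \<le> x" "x \<le> 1 / 4"
  shows "qpoch x n \<ge> 1 / 2"
proof -
  have "(\<Sum>i<n. x ^ Suc i) = x * (\<Sum>i<n. x ^ i)" by (simp add: sum_distrib_left)
  also have "\<dots> \<le> x * (1 / (1 - x))"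
  proof (rule mult_left_mono)
    have "(\<Sum>i<n. x ^ i) = (1 - x ^ n) / (1 - x)" using assms by (simp add: sum_gp_strict)
    also have "\<dots> \<le> 1 / (1 - x)" using assms by (intro divide_right_mono) auto
    finally show "(\<Sum>i<n. x ^ i) \<le> 1 / (1 - x)" .
  qed (use assms in auto)
  also have "\<dots> \<le> 1 / 2" using assms by (simp add: field_simps)
  finally have "1 / 2 \<le> 1 - (\<Sum>i<n. x ^ Suc i)" by simp
  also have "\<dots> \<le> qpoch x n"
    unfolding qpoch_def using assms
    by (intro Weierstrass_prod_ineq) (auto simp: power_le_one simp del: power_Suc)
  finally show ?thesis .
qed

lemma qpoch_tendsto:
  assumes "0 \<le> x" "x \<le> 1 / 4"
  shows "\<exists>L>0. qpoch x \<longlonglongrightarrow> L"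
proof -
  have x: "0 \<le> x" "x < 1" using assms by auto
  have "decseq (qpoch x)"
  proof (rule decseq_SucI)
    fix n
    have "qpoch x n * (1 - x ^ Suc n) \<le> qpoch x n * 1"
      using qpoch_pos[OF x, of n] x by (intro mult_left_mono) auto
    then show "qpoch x (Suc n) \<le> qpoch x n" by (simp add: qpoch_Suc)
  qed
  then obtain L where L: "qpoch x \<longlonglongrightarrow> L"
    by (rule decseq_convergent[of "qpoch x" "1 / 2"]) (use qpoch_ge_half[OF assms] in auto)
  moreover have "L \<ge> 1 / 2" using qpoch_ge_half[OF assms] by (intro LIMSEQ_le_const[OF L]) auto
  ultimately show ?thesis by (intro exI[of _ L]) auto
qed

text \<open>With \<open>s m = m\<close> the sum is a finite Euler product, with \<open>s m = m div 2\<close> it is the normalised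
  number of involutions; Tannery's theorem gives both the same limit.\<close>

lemma qpoch_sum_tendsto:
  fixes x :: real and y :: "nat \<Rightarrow> real"
  assumes x: "0 \<le> x" "x \<le> 1 / 4" and y: "\<And>j. 0 \<le> y j" "summable y"
    and s: "filterlim s at_top sequentially"
  shows "(\<lambda>n. \<Sum>j\<le>n. y j * (qpoch x n / (qpoch x j * qpoch x (s (n - j))))) \<longlonglongrightarrow>
    (\<Sum>j. y j / qpoch x j)"
proof -
  \<comment> \<open>Extension by \<open>0\<close> beyond \<open>n\<close> turns the finite sums into
    series over a fixed index set, as dominated convergence requires.\<close>
  define a where "a j n = (if j \<le> n then y j * (qpoch x n / (qpoch x j * qpoch x (s (n - j)))) else 0)" for j n
  obtain L where L: "L > 0" "qpoch x \<longlonglongrightarrow> L" using qpoch_tendsto[OF x] by auto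
  have pos: "qpoch x n > 0" and le1: "qpoch x n \<le> 1" for n
    using qpoch_pos[of x n] qpoch_le_1[of x n] x by auto
  have lim: "a j \<longlonglongrightarrow> y j / qpoch x j" for j
  proof -
    have "filterlim (\<lambda>n. s (n - j)) at_top sequentially"
      by (rule filterlim_compose[OF s filterlim_minus_const_nat_at_top])
    then have "(\<lambda>n. qpoch x (s (n - j))) \<longlonglongrightarrow> L"
      by (rule filterlim_compose[OF L(2)])
    then have "(\<lambda>n. y j * (qpoch x n / (qpoch x j * qpoch x (s (n - j))))) \<longlonglongrightarrow> y j * (L / (qpoch x j * L))"
      using L pos[of j] by (intro tendsto_intros) auto
    \<comment> \<open>\<open>L\<close> cancels because it is positive, so the limit does not depend
      on \<open>s\<close>.\<close>
    then have "(\<lambda>n. y j * (qpoch x n / (qpoch x j * qpoch x (s (n - j))))) \<longlonglongrightarrow> y j / qpoch x j"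
      using L by simp
    then show ?thesis
      by (rule Lim_transform_eventually) (auto simp: a_def eventually_sequentially intro!: exI[of _ j])
  qed
  have bound: "norm (a j n) \<le> 4 * y j" for j n
  proof (cases "j \<le> n")
    case True
    \<comment> \<open>Both factors of the denominator are at least \<open>1 / 2\<close> and the
      numerator is at most \<open>1\<close>; hence the constant \<open>4\<close>.\<close>
    have "1 / 2 * (1 / 2) \<le> qpoch x j * qpoch x (s (n - j))"
      using x by (intro mult_mono qpoch_ge_half) (auto intro: less_imp_le[OF pos])
    then have d: "1 / 4 \<le> qpoch x j * qpoch x (s (n - j))" by simp
    have "qpoch x n / (qpoch x j * qpoch x (s (n - j))) \<le> 1 / (1 / 4)"
      using d le1[of n] pos[of n] by (intro frac_le) auto
    then have "y j * (qpoch x n / (qpoch x j * qpoch x (s (n - j)))) \<le> y j * 4"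
      using y by (intro mult_left_mono) auto
    moreover have "0 \<le> y j * (qpoch x n / (qpoch x j * qpoch x (s (n - j))))"
      using y by (intro mult_nonneg_nonneg divide_nonneg_nonneg) (auto intro: less_imp_le[OF pos])
    ultimately show ?thesis using True by (simp add: a_def)
  qed (use y in \<open>simp add: a_def\<close>)
  have ev: "eventually (\<lambda>(k, n). norm (a k n) \<le> 4 * y k) (sequentially \<times>\<^sub>F sequentially)"
    using bound by (intro always_eventually) auto
  have "((\<lambda>n. suminf (\<lambda>k. a k n)) \<longlonglongrightarrow> (\<Sum>j. y j / qpoch x j))"
    using tannerys_theorem[OF lim ev summable_mult[OF y(2)] sequentially_bot] by blast
  moreover have "suminf (\<lambda>k. a k n) = (\<Sum>j\<le>n. y j * (qpoch x n / (qpoch x j * qpoch x (s (n - j)))))" for n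
    by (subst suminf_finite[of "{..n}"]) (auto simp: a_def)
  ultimately show ?thesis by simp
qed

section \<open>Gaussian binomials and the Euler product\<close>

lemma qpoch_pascal:
  assumes x: "0 \<le> x" "x < 1" and j: "j < n"
  shows "qpoch x (Suc n) / (qpoch x (Suc j) * qpoch x (n - j)) =
    qpoch x n / (qpoch x (Suc j) * qpoch x (n - Suc j)) +
    x ^ (n - j) * (qpoch x n / (qpoch x j * qpoch x (n - j)))"
proof -
  define m where "m = n - Suc j"
  have n: "n = Suc (j + m)" "n - j = Suc m" using j by (auto simp: m_def)
  have pos: "qpoch x n \<noteq> 0" for n using qpoch_pos[OF x, of n] by simp
  have nz: "1 - x ^ Suc k \<noteq> 0" for k
    using pos[of "Suc k"] by (simp add: qpoch_Suc)
  have "x ^ Suc n = x ^ Suc m * x ^ Suc j" unfolding n by (simp add: power_add)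
  \<comment> \<open>The Pascal rule comes from this splitting of the new factor: each of its two
    parts cancels one factor of the denominator.\<close>
  then have E: "1 - x ^ Suc n = (1 - x ^ Suc m) + x ^ Suc m * (1 - x ^ Suc j)"
    by (simp add: algebra_simps del: power_Suc)
  then show ?thesis
    unfolding n(2) m_def[symmetric] qpoch_Suc[of x n] qpoch_Suc[of x j] qpoch_Suc[of x m] E
    using pos[of j] pos[of m] nz[of j] nz[of m]
    by (simp add: divide_simps del: power_Suc) (simp add: algebra_simps del: power_Suc)
qed

text \<open>The recursion makes \<open>y j = x ^ (j (j + 1) / 2)\<close>, so this is the \<open>q\<close>-binomial theorem for
  \<open>\<Prod> (1 + z x ^ i)\<close> at \<open>z = 1\<close>.\<close>

lemma euler_product_finite:
  fixes x :: real and y :: "nat \<Rightarrow> real"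
  assumes x: "0 \<le> x" "x < 1" and y: "y 0 = 1" "\<And>j. y (Suc j) = y j * x ^ Suc j"
  shows "(\<Prod>i<n. 1 + x ^ Suc i) = (\<Sum>j\<le>n. y j * (qpoch x n / (qpoch x j * qpoch x (n - j))))"
proof (induction n)
  case 0
  then show ?case using y by simp
next
  case (Suc n)
  have pos: "qpoch x n \<noteq> 0" for n using qpoch_pos[OF x, of n] by simp
  let ?b = "\<lambda>n j. qpoch x n / (qpoch x j * qpoch x (n - j))"
  have "(\<Sum>j\<le>Suc n. y j * ?b (Suc n) j) = y 0 + (\<Sum>j\<le>n. y (Suc j) * ?b (Suc n) (Suc j))"
    using pos by (simp add: sum.atMost_Suc_shift del: sum.atMost_Suc)
  \<comment> \<open>The last term is set apart because the Pascal rule is available only for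
    \<open>j < n\<close>.\<close>
  also have "(\<Sum>j\<le>n. y (Suc j) * ?b (Suc n) (Suc j)) =
      (\<Sum>j<n. y (Suc j) * ?b (Suc n) (Suc j)) + y (Suc n)"
    using pos by (simp add: lessThan_Suc_atMost[symmetric])
  also have "(\<Sum>j<n. y (Suc j) * ?b (Suc n) (Suc j)) =
      (\<Sum>j<n. y (Suc j) * ?b n (Suc j)) + (\<Sum>j<n. x ^ Suc n * (y j * ?b n j))"
    unfolding sum.distrib[symmetric]
  proof (rule sum.cong[OF refl])
    fix j assume "j \<in> {..<n}"
    then have j: "j < n" by simp
    \<comment> \<open>The power from the recursion of \<open>y\<close> and the one from the Pascal
      rule combine to \<open>x ^ Suc n\<close>, independent of \<open>j\<close>; this becomes the
      new factor of the product.\<close>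
    have "x ^ Suc j * x ^ (n - j) = x ^ Suc n" using j by (simp flip: power_add)
    then have "y (Suc j) * (x ^ (n - j) * ?b n j) = x ^ Suc n * (y j * ?b n j)"
      by (simp only: y mult_ac) (simp only: flip: mult.assoc)
    then show "y (Suc j) * ?b (Suc n) (Suc j) = y (Suc j) * ?b n (Suc j) + x ^ Suc n * (y j * ?b n j)"
      using qpoch_pascal[OF x j] by (simp add: distrib_left)
  qed
  also have "y (Suc n) = x ^ Suc n * (y n * ?b n n)" using pos by (simp add: y)
  also have "y 0 + ((\<Sum>j<n. y (Suc j) * ?b n (Suc j)) + (\<Sum>j<n. x ^ Suc n * (y j * ?b n j)) +
      x ^ Suc n * (y n * ?b n n)) =
      (y 0 * ?b n 0 + (\<Sum>j<n. y (Suc j) * ?b n (Suc j))) + (\<Sum>j<Suc n. x ^ Suc n * (y j * ?b n j))"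
    using pos by simp
  also have "y 0 * ?b n 0 + (\<Sum>j<n. y (Suc j) * ?b n (Suc j)) = (\<Sum>j<Suc n. y j * ?b n j)"
    by (rule sum.lessThan_Suc_shift[symmetric])
  also have "\<dots> + (\<Sum>j<Suc n. x ^ Suc n * (y j * ?b n j)) = (\<Sum>j\<le>n. y j * ?b n j) * (1 + x ^ Suc n)"
    unfolding lessThan_Suc_atMost sum_distrib_left[symmetric] 
    by (simp only: distrib_left mult_1_right) (simp only: mult.commute)
  finally show ?case using Suc.IH by simp
qed

lemma euler_product_tendsto:
  fixes x :: real
  assumes "0 \<le> x" "x < 1"
  shows "(\<lambda>n. \<Prod>i<n. 1 + x ^ Suc i) \<longlonglongrightarrow> (\<Prod>i. 1 + x ^ Suc i)"
proof -
  have "summable (\<lambda>i. x ^ Suc i)" using assms by (intro summable_ignore_initial_segment[of _ 1, simplified] summable_geometric) auto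
  then have "summable (\<lambda>i. \<bar>x ^ Suc i\<bar>)" using assms by (simp del: power_Suc)
  moreover have "x ^ Suc i \<noteq> - 1" for i
  proof -
    have "x ^ Suc i \<ge> 0" using assms by simp
    then show ?thesis by linarith
  qed
  ultimately have "convergent_prod (\<lambda>i. 1 + x ^ Suc i)"
    by (rule summable_imp_convergent_prod_real)
  then show ?thesis using convergent_prod_has_prod has_prod_imp_tendsto' by blast
qed

section \<open>The explicit solution at \<open>x = 1 / q ^ 2\<close>\<close>

context
  fixes q :: real
  assumes q: "q \<ge> 2"
begin

text \<open>This is \<open>x ^ (j (j + 1) / 2)\<close> at \<open>x = 1 / q ^ 2\<close>, written
  without halving the exponent.\<close>

definition gterm :: "nat \<Rightarrow> real" where
  "gterm j = 1 / q ^ (j * (j + 1))"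

lemma gterm_Suc: "gterm (Suc j) = gterm j * (1 / q\<^sup>2) ^ Suc j"
proof -
  have "Suc j * (Suc j + 1) = j * (j + 1) + 2 * Suc j" by simp
  then show ?thesis by (simp only: gterm_def power_add power_mult) (simp add: power_one_over)
qed

lemma gterm_summable: "summable gterm"
proof (rule summable_comparison_test)
  show "summable (\<lambda>j. (1 / 2 :: real) ^ j)" by (rule summable_geometric) simp
  have "gterm j \<le> (1 / 2) ^ j" for j
  proof -
    have "(2::real) ^ j \<le> 2 ^ (j * (j + 1))" by (rule power_increasing) auto
    also have "\<dots> \<le> q ^ (j * (j + 1))" using q by (intro power_mono) auto
    finally show ?thesis using q by (simp add: gterm_def power_one_over field_simps)
  qed
  then show "\<exists>N. \<forall>n\<ge>N. norm (gterm n) \<le> (1 / 2) ^ n" using q by (simp add: gterm_def)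
qed

text \<open>This will be the number of square-zero self-adjoint maps with kernel of dimension \<open>n + j\<close> on a
  symplectic space of dimension \<open>2 n\<close>.\<close>

definition sqzero_count :: "nat \<Rightarrow> nat \<Rightarrow> real" where
  "sqzero_count j n = (if j \<le> n then q ^ (n\<^sup>2 + n) * (gterm j *
     (qpoch (1 / q\<^sup>2) n / (qpoch (1 / q\<^sup>2) j * qpoch (1 / q\<^sup>2) ((n - j) div 2)))) else 0)"

lemma sqzero_count_tendsto:
  "(\<lambda>n. (\<Sum>j\<le>n. sqzero_count j n) / q ^ (n\<^sup>2 + n)) \<longlonglongrightarrow> (\<Prod>i. 1 + 1 / q ^ (2 * Suc i))"
proof -
  let ?x = "1 / q\<^sup>2"
  have "2\<^sup>2 \<le> q\<^sup>2" using q by (intro power_mono) auto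
  then have x: "0 \<le> ?x" "?x \<le> 1 / 4" "?x < 1" using q by (auto simp: field_simps)
  have y: "gterm 0 = 1" "\<And>j. 0 \<le> gterm j" using q by (auto simp: gterm_def)
  have "filterlim (\<lambda>m::nat. m) at_top sequentially" by (rule filterlim_ident)
  \<comment> \<open>Two limits of the same sequence of finite products evaluate the series.\<close>
  from qpoch_sum_tendsto[OF x(1,2) y(2) gterm_summable this]
  have "(\<lambda>n. \<Prod>i<n. 1 + ?x ^ Suc i) \<longlonglongrightarrow> (\<Sum>j. gterm j / qpoch ?x j)"
    unfolding euler_product_finite[OF x(1,3) y(1) gterm_Suc] .
  then have eq: "(\<Sum>j. gterm j / qpoch ?x j) = (\<Prod>i. 1 + ?x ^ Suc i)"
    using euler_product_tendsto[OF x(1,3)] by (rule LIMSEQ_unique)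
  have half: "filterlim (\<lambda>m::nat. m div 2) at_top sequentially"
    unfolding filterlim_at_top eventually_sequentially
    by (metis div_le_mono nonzero_mult_div_cancel_left numeral_neq_zero)
  have "(\<Sum>j\<le>n. sqzero_count j n) / q ^ (n\<^sup>2 + n) =
      (\<Sum>j\<le>n. gterm j * (qpoch ?x n / (qpoch ?x j * qpoch ?x ((n - j) div 2))))" for n
    unfolding sum_divide_distrib using q by (intro sum.cong) (auto simp: sqzero_count_def)
  moreover have "1 / q ^ (2 * Suc i) = ?x ^ Suc i" for i
    by (simp only: power_mult power_one_over)
  ultimately show ?thesis
    using qpoch_sum_tendsto[OF x(1,2) y(2) gterm_summable half] by (simp only: eq)
qed

lemma qpoch_q_pos: "qpoch (1 / q\<^sup>2) k > 0"
proof -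
  have "q\<^sup>2 \<ge> 2\<^sup>2" using q by (intro power_mono) auto
  then have "1 < q\<^sup>2" by simp
  then have "1 / q\<^sup>2 < 1" by (smt (verit) divide_less_eq_1)
  then show ?thesis by (intro qpoch_pos) auto
qed

lemma sqzero_count_self [simp]: "sqzero_count n n = 1"
proof -
  have "qpoch (1 / q\<^sup>2) n \<noteq> 0" using qpoch_q_pos[of n] by simp
  then show ?thesis using q by (simp add: sqzero_count_def gterm_def power2_eq_square)
qed

lemma qpoch_Suc_q:
  "qpoch (1 / q\<^sup>2) (Suc k) = qpoch (1 / q\<^sup>2) k * ((q\<^sup>2 * (q ^ k)\<^sup>2 - 1) / (q\<^sup>2 * (q ^ k)\<^sup>2))"
proof -
  have "(1 / q\<^sup>2) ^ Suc k = 1 / (q\<^sup>2 * (q ^ k)\<^sup>2)"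
    by (simp add: power_one_over mult.commute[of k] flip: power_mult)
  then show ?thesis using q by (simp only: qpoch_Suc) (simp add: field_simps)
qed

lemma q_power_gt_1: "q\<^sup>2 * (q ^ k)\<^sup>2 > 1"
proof -
  have "1 < q ^ (2 * Suc k)" using q by (intro one_less_power) auto
  also have "q ^ (2 * Suc k) = q\<^sup>2 * (q ^ k)\<^sup>2" by (simp add: power2_eq_square mult_2 power_add mult.assoc)
  finally show ?thesis by simp
qed

text \<open>The leading power gains \<open>q ^ (2 k + 2)\<close> and the numerator gains
  \<open>1 - x ^ (k + 1)\<close>; their product is \<open>q ^ 2 u ^ 2 - 1\<close>. The remaining
  symbol stays on both sides because its growth depends on the parity of
  \<open>k - j\<close>.\<close>

lemma sqzero_count_step:
  assumes "j \<le> k" and u: "u = q ^ k"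
  shows "sqzero_count j (Suc k) * qpoch (1 / q\<^sup>2) ((Suc k - j) div 2) =
    sqzero_count j k * qpoch (1 / q\<^sup>2) ((k - j) div 2) * (q\<^sup>2 * u\<^sup>2 - 1)"
proof -
  have "(Suc k)\<^sup>2 + Suc k = (k\<^sup>2 + k) + 2 + (k + k)" by (simp add: power2_eq_square)
  then have E: "q ^ ((Suc k)\<^sup>2 + Suc k) = q ^ (k\<^sup>2 + k) * q\<^sup>2 * u\<^sup>2"
    by (simp only: power_add u power2_eq_square)
  have "u > 0" using q by (simp add: u)
  then show ?thesis
    using assms(1) qpoch_q_pos[of "(Suc k - j) div 2"] qpoch_q_pos[of "(k - j) div 2"] qpoch_q_pos[of j] q
    unfolding sqzero_count_def E qpoch_Suc_q u[symmetric] by (simp add: divide_simps)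
qed

text \<open>Over two steps \<open>(n - j) div 2\<close> grows once, at the second step if
  \<open>n - j\<close> is even and at the first if it is odd. In either case the recurrence becomes
  a polynomial identity in \<open>q\<close>, \<open>q ^ j\<close> and \<open>q ^ s\<close>.\<close>

lemma sqzero_count_rec:
  assumes "j < n"
  shows "sqzero_count j n * (q ^ (2 * n) - q ^ (n + j)) = (q ^ (2 * n) - 1) *
    ((q ^ (2 * n) - q ^ (2 * n - 1)) * sqzero_count j (n - 1) +
    (q ^ (2 * n - 1) - q) * (q ^ (2 * n - 2) * sqzero_count j (n - 2)))"
proof -
  let ?x = "1 / q\<^sup>2"
  have q0: "q > 0" using q by simp
  note pos = qpoch_q_pos
  consider "n = Suc j" | s where "n = Suc (Suc (j + (2 * s)))" | s where "n = Suc (Suc (j + Suc (2 * s)))"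
  proof -
    obtain m where m: "n = Suc (j + m)" using assms less_imp_Suc_add by auto
    show ?thesis
    proof (cases m)
      case 0 then show ?thesis using that m by simp
    next
      case (Suc m')
      then show ?thesis using that(2)[of "m' div 2"] that(3)[of "m' div 2"] m
        by (cases "even m'") auto
    qed
  qed
  then show ?thesis
  proof cases
    case 1
    have c: "sqzero_count j n = q\<^sup>2 * (q ^ j)\<^sup>2 - 1"
      using sqzero_count_step[of j j, OF _ refl] unfolding 1 by simp
    \<comment> \<open>If \<open>j > 0\<close> then \<open>n - 2 < j\<close> and the count is
      \<open>0\<close>; if \<open>j = 0\<close> then \<open>n = 1\<close> and the first factor is
      \<open>0\<close>.\<close>
    have z: "(q ^ (2 * n - 1) - q) * sqzero_count j (n - 2) = 0"
      using 1 by (cases "j = 0") (auto simp: sqzero_count_def)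
    have e: "q ^ (2 * n) = q\<^sup>2 * (q ^ j)\<^sup>2" "q ^ (2 * n - 1) = q ^ (n + j)"
      unfolding 1 by (simp_all add: power_add mult_2 power2_eq_square mult.assoc)
    have Z: "(q ^ (2 * n - 1) - q) * (q ^ (2 * n - 2) * sqzero_count j (n - 2)) = 0"
      using z unfolding mult_eq_0_iff by blast
    have s: "sqzero_count j (n - 1) = 1" using 1 by simp
    show ?thesis unfolding c Z s unfolding e by simp
  next
    case (2 s)
    define k where "k = j + 2 * s"
    define u v t where "u = q ^ k" and "v = q ^ j" and "t = q ^ s"
    have n: "n = Suc (Suc k)" using 2 by (simp add: k_def)
    have u: "u = v * t\<^sup>2" by (simp add: u_def v_def t_def k_def power_add power_even_eq)
    have d: "(n - j) div 2 = Suc s" "(Suc k - j) div 2 = s" "(k - j) div 2 = s"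
      using 2 by (auto simp: k_def)
    have d0: "q\<^sup>2 * t\<^sup>2 - 1 > 0" using q_power_gt_1[of s] by (simp add: t_def)
    have t0: "t > 0" using q0 by (simp add: t_def)
    have e: "q ^ (2 * n) = q ^ 4 * u\<^sup>2" "q ^ (2 * n - 1) = q ^ 3 * u\<^sup>2" "q ^ (2 * n - 2) = q\<^sup>2 * u\<^sup>2"
      "q ^ (n + j) = q\<^sup>2 * u * v"
      unfolding n u_def v_def by (simp_all add: power_add power_even_eq power2_eq_square eval_nat_numeral)
    have S: "qpoch ?x (Suc s) * (q\<^sup>2 * t\<^sup>2) = qpoch ?x s * (q\<^sup>2 * t\<^sup>2 - 1)"
      using t0 q0 by (simp add: qpoch_Suc_q flip: t_def)
    have w: "q\<^sup>2 * (q * u)\<^sup>2 = q ^ 4 * u\<^sup>2" by (simp add: power_mult_distrib flip: power_add mult.assoc)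
    have st1: "sqzero_count j (Suc k) * qpoch ?x (s) = sqzero_count j k * qpoch ?x (s) * (q\<^sup>2 * u\<^sup>2 - 1)"
      using sqzero_count_step[OF _ u_def, of j] unfolding d by (simp add: k_def)
    have st2: "sqzero_count j n * qpoch ?x (Suc s) = sqzero_count j (Suc k) * qpoch ?x (s) * (q ^ 4 * u\<^sup>2 - 1)"
      using sqzero_count_step[of j "Suc k" "q * u"] unfolding n[symmetric] d w by (simp add: k_def u_def)
    have c1: "sqzero_count j (Suc k) = sqzero_count j k * (q\<^sup>2 * u\<^sup>2 - 1)" using st1 pos[of s] by simp
    have c2: "sqzero_count j n * (q\<^sup>2 * t\<^sup>2 - 1) = sqzero_count j (Suc k) * (q ^ 4 * u\<^sup>2 - 1) * (q\<^sup>2 * t\<^sup>2)"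
    proof -
      have "(sqzero_count j n * (q\<^sup>2 * t\<^sup>2 - 1)) * qpoch ?x s = sqzero_count j n * (qpoch ?x (Suc s) * (q\<^sup>2 * t\<^sup>2))"
        unfolding S by (simp add: mult_ac)
      also have "\<dots> = (sqzero_count j n * qpoch ?x (Suc s)) * (q\<^sup>2 * t\<^sup>2)" by simp
      also have "\<dots> = (sqzero_count j (Suc k) * (q ^ 4 * u\<^sup>2 - 1) * (q\<^sup>2 * t\<^sup>2)) * qpoch ?x s"
        unfolding st2 by (simp add: mult_ac)
      finally show ?thesis using pos[of s] by simp
    qed
    \<comment> \<open>As \<open>u = v t ^ 2\<close>, the left factor contains
      \<open>q ^ 2 t ^ 2 - 1\<close>, which is what \<open>c2\<close> absorbs.\<close>
    have "sqzero_count j n * (q ^ 4 * u\<^sup>2 - q\<^sup>2 * u * v) =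
        (sqzero_count j n * (q\<^sup>2 * t\<^sup>2 - 1)) * (q\<^sup>2 * u * v)"
      unfolding u by (simp add: algebra_simps power2_eq_square eval_nat_numeral)
    also have "\<dots> = (q ^ 4 * u\<^sup>2 - 1) *
        ((q ^ 4 * u\<^sup>2 - q ^ 3 * u\<^sup>2) * sqzero_count j (Suc k) +
        (q ^ 3 * u\<^sup>2 - q) * (q\<^sup>2 * u\<^sup>2 * sqzero_count j k))"
      unfolding c2 c1 unfolding u by (simp add: algebra_simps power2_eq_square eval_nat_numeral)
    finally show ?thesis unfolding e by (simp add: n)
  next
    case (3 s)
    define k where "k = j + Suc (2 * s)"
    define u v t where "u = q ^ k" and "v = q ^ j" and "t = q ^ s"
    have n: "n = Suc (Suc k)" using 3 by (simp add: k_def)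
    have u: "u = q * v * t\<^sup>2" by (simp add: u_def v_def t_def k_def power_add power_even_eq)
    have d: "(n - j) div 2 = Suc s" "(Suc k - j) div 2 = Suc s" "(k - j) div 2 = s"
      using 3 by (auto simp: k_def)
    have d0: "q\<^sup>2 * t\<^sup>2 - 1 > 0" using q_power_gt_1[of s] by (simp add: t_def)
    have t0: "t > 0" using q0 by (simp add: t_def)
    have e: "q ^ (2 * n) = q ^ 4 * u\<^sup>2" "q ^ (2 * n - 1) = q ^ 3 * u\<^sup>2" "q ^ (2 * n - 2) = q\<^sup>2 * u\<^sup>2"
      "q ^ (n + j) = q\<^sup>2 * u * v"
      unfolding n u_def v_def by (simp_all add: power_add power_even_eq power2_eq_square eval_nat_numeral)
    have S: "qpoch ?x (Suc s) * (q\<^sup>2 * t\<^sup>2) = qpoch ?x s * (q\<^sup>2 * t\<^sup>2 - 1)"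
      using t0 q0 by (simp add: qpoch_Suc_q flip: t_def)
    have w: "q\<^sup>2 * (q * u)\<^sup>2 = q ^ 4 * u\<^sup>2" by (simp add: power_mult_distrib flip: power_add mult.assoc)
    have st1: "sqzero_count j (Suc k) * qpoch ?x (Suc s) = sqzero_count j k * qpoch ?x (s) * (q\<^sup>2 * u\<^sup>2 - 1)"
      using sqzero_count_step[OF _ u_def, of j] unfolding d by (simp add: k_def)
    have st2: "sqzero_count j n * qpoch ?x (Suc s) = sqzero_count j (Suc k) * qpoch ?x (Suc s) * (q ^ 4 * u\<^sup>2 - 1)"
      using sqzero_count_step[of j "Suc k" "q * u"] unfolding n[symmetric] d w by (simp add: k_def u_def)
    have c1: "sqzero_count j (Suc k) * (q\<^sup>2 * t\<^sup>2 - 1) = sqzero_count j k * (q\<^sup>2 * u\<^sup>2 - 1) * (q\<^sup>2 * t\<^sup>2)"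
    proof -
      have "(sqzero_count j (Suc k) * (q\<^sup>2 * t\<^sup>2 - 1)) * qpoch ?x s = sqzero_count j (Suc k) * (qpoch ?x (Suc s) * (q\<^sup>2 * t\<^sup>2))"
        unfolding S by (simp add: mult_ac)
      also have "\<dots> = (sqzero_count j (Suc k) * qpoch ?x (Suc s)) * (q\<^sup>2 * t\<^sup>2)" by simp
      also have "\<dots> = (sqzero_count j k * (q\<^sup>2 * u\<^sup>2 - 1) * (q\<^sup>2 * t\<^sup>2)) * qpoch ?x s"
        unfolding st1 by (simp add: mult_ac)
      finally show ?thesis using pos[of s] by simp
    qed
    have c2: "sqzero_count j n = sqzero_count j (Suc k) * (q ^ 4 * u\<^sup>2 - 1)" using st2 pos[of "Suc s"] by simp
    \<comment> \<open>Here \<open>q ^ 2 t ^ 2 - 1\<close> belongs to the step from \<open>k\<close>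
      to \<open>Suc k\<close>, so both sides are multiplied by it and it is cancelled at the
      end.\<close>
    have "(sqzero_count j n * (q ^ 4 * u\<^sup>2 - q\<^sup>2 * u * v)) * (q\<^sup>2 * t\<^sup>2 - 1) =
        (sqzero_count j (Suc k) * (q\<^sup>2 * t\<^sup>2 - 1)) * ((q ^ 4 * u\<^sup>2 - 1) * (q ^ 4 * u\<^sup>2 - q\<^sup>2 * u * v))"
      unfolding c2 by (simp add: mult_ac)
    also have "\<dots> = (q ^ 4 * u\<^sup>2 - 1) *
        ((q ^ 4 * u\<^sup>2 - q ^ 3 * u\<^sup>2) * (sqzero_count j (Suc k) * (q\<^sup>2 * t\<^sup>2 - 1)) +
        (q ^ 3 * u\<^sup>2 - q) * (q\<^sup>2 * u\<^sup>2 * sqzero_count j k) * (q\<^sup>2 * t\<^sup>2 - 1))"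
      unfolding c1 unfolding u by (simp add: algebra_simps power2_eq_square eval_nat_numeral)
    also have "\<dots> = ((q ^ 4 * u\<^sup>2 - 1) *
        ((q ^ 4 * u\<^sup>2 - q ^ 3 * u\<^sup>2) * sqzero_count j (Suc k) +
        (q ^ 3 * u\<^sup>2 - q) * (q\<^sup>2 * u\<^sup>2 * sqzero_count j k))) * (q\<^sup>2 * t\<^sup>2 - 1)"
      by (simp only: distrib_left distrib_right mult_ac)
    finally show ?thesis unfolding e using d0 by (simp add: n)
  qed
qed

end

subsection \<open>Involutions of the symplectic group\<close>

text \<open>The space of all coefficient functions is infinite-dimensional, but carries the pulled-back form
  on all of it; \<open>carrier_vec m\<close> corresponds to \<open>fun_space m\<close>.\<close>

definition fun_scale :: "'a::field \<Rightarrow> (nat \<Rightarrow> 'a) \<Rightarrow> nat \<Rightarrow> 'a" where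
  "fun_scale c f = (\<lambda>i. c * f i)"

definition fun_space :: "nat \<Rightarrow> (nat \<Rightarrow> 'a::field) set" where
  "fun_space m = {f. \<forall>i\<ge>m. f i = 0}"

definition vec_form :: "nat \<Rightarrow> ('a::field vec \<Rightarrow> 'a vec \<Rightarrow> 'a) \<Rightarrow> (nat \<Rightarrow> 'a) \<Rightarrow> (nat \<Rightarrow> 'a) \<Rightarrow> 'a" where
  "vec_form m \<beta> f h = \<beta> (vec m f) (vec m h)"

definition unvec :: "nat \<Rightarrow> 'a::field vec \<Rightarrow> nat \<Rightarrow> 'a" where
  "unvec m v = (\<lambda>i. if i < m then v $ i else 0)"

lemma vec_add: "vec m (f + h) = vec m f + vec m h"
  by (intro eq_vecI) auto

lemma vec_fun_scale: "vec m (fun_scale c f) = c \<cdot>\<^sub>v vec m f"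
  by (intro eq_vecI) (auto simp: fun_scale_def)

lemma vec_unvec: "v \<in> carrier_vec m \<Longrightarrow> vec m (unvec m v) = v"
  by (intro eq_vecI) (auto simp: unvec_def)

lemma unvec_vec: "f \<in> fun_space m \<Longrightarrow> unvec m (vec m f) = f"
  by (auto simp: unvec_def fun_space_def)

lemma unvec_in_fun_space [simp]: "unvec m v \<in> fun_space m"
  by (simp add: unvec_def fun_space_def)

lemma unvec_add: "v \<in> carrier_vec m \<Longrightarrow> w \<in> carrier_vec m \<Longrightarrow> unvec m (v + w) = unvec m v + unvec m w"
  by (auto simp: unvec_def fun_eq_iff)

lemma unvec_smult: "v \<in> carrier_vec m \<Longrightarrow> unvec m (c \<cdot>\<^sub>v v) = fun_scale c (unvec m v)"
  by (auto simp: unvec_def fun_scale_def fun_eq_iff)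

lemma vector_space_fun_scale: "vector_space (fun_scale :: 'a::field \<Rightarrow> _)"
  by unfold_locales (auto simp: fun_scale_def fun_eq_iff algebra_simps)

lemma subspace_fun_space: "module.subspace fun_scale (fun_space m :: (nat \<Rightarrow> 'a::field) set)"
proof -
  interpret vector_space "fun_scale :: 'a \<Rightarrow> _" by (rule vector_space_fun_scale)
  show ?thesis by (rule subspaceI) (auto simp: fun_space_def fun_scale_def)
qed

lemma card_fun_space: "card (fun_space m :: (nat \<Rightarrow> 'a::{field,finite}) set) = CARD('a) ^ m"
proof -
  have "bij_betw (\<lambda>f. restrict f {..<m}) (fun_space m :: (nat \<Rightarrow> 'a) set) (PiE {..<m} (\<lambda>_. UNIV))"
    by (rule bij_betw_byWitness[where f' = "\<lambda>f i. if i < m then f i else 0"])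
       (auto simp: fun_space_def fun_eq_iff PiE_def extensional_def)
  from bij_betw_same_card[OF this] show ?thesis by (simp add: card_PiE)
qed

lemma char2_alternating_vec_form:
  fixes \<beta> :: "'a::{field,finite} vec \<Rightarrow> 'a vec \<Rightarrow> 'a"
  assumes "alternating_form m \<beta>" "(1::'a) + 1 = 0"
  shows "char2_alternating fun_scale (vec_form m \<beta>)"
proof -
  interpret vector_space "fun_scale :: 'a \<Rightarrow> _" by (rule vector_space_fun_scale)
  show ?thesis
    using assms by unfold_locales
      (auto simp: alternating_form_def bilinear_form_def vec_form_def vec_add vec_fun_scale)
qed

lemma mat_eqI_mult_vec:
  fixes A :: "'a::field mat"
  assumes A: "A \<in> carrier_mat m m" and B: "B \<in> carrier_mat m m"
    and eq: "\<And>v. v \<in> carrier_vec m \<Longrightarrow> A *\<^sub>v v = B *\<^sub>v v"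
  shows "A = B"
proof (rule eq_matI)
  fix i j assume "i < dim_row B" "j < dim_col B"
  then have ij: "i < m" "j < m" using B by auto
  have "(A *\<^sub>v unit_vec m j) $ i = (B *\<^sub>v unit_vec m j) $ i" using eq by simp
  then show "A $$ (i, j) = B $$ (i, j)" using ij A B by simp
qed (use A B in auto)

section \<open>Involutions as square-zero maps\<close>

lemma involutions_symplectic_group:
  "involutions (symplectic_group m \<beta>) = {g \<in> carrier_mat m m. g * g = 1\<^sub>m m \<and>
     (\<forall>x\<in>carrier_vec m. \<forall>y\<in>carrier_vec m. \<beta> (g *\<^sub>v x) (g *\<^sub>v y) = \<beta> x y)}"
  by (auto simp: involutions_def symplectic_group_def invertible_mat_def inverts_mat_def)

text \<open>This lets an abstract linear map be represented by a matrix. The induction runs over the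
  number of coordinates of \<open>f\<close> that are kept.\<close>

lemma additive_expansion:
  fixes N :: "(nat \<Rightarrow> 'a::field) \<Rightarrow> nat \<Rightarrow> 'a"
  assumes add: "\<And>f h. f \<in> fun_space m \<Longrightarrow> h \<in> fun_space m \<Longrightarrow> N (f + h) = N f + N h"
    and scale: "\<And>c f. f \<in> fun_space m \<Longrightarrow> N (fun_scale c f) = fun_scale c (N f)"
    and f: "f \<in> fun_space m"
  shows "N f i = (\<Sum>j<m. f j * N (\<lambda>i. if i = j then 1 else 0) i)"
proof -
  have e: "(\<lambda>i. if i = j then 1 else 0) \<in> fun_space m" if "j < m" for j
    using that by (simp add: fun_space_def)
  have "N (\<lambda>i. if i < k then f i else 0) i = (\<Sum>j<k. f j * N (\<lambda>i. if i = j then 1 else 0) i)"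
    if "k \<le> m" for k
    using that
  proof (induction k)
    case 0
    have "N (fun_scale 0 f) i = 0" using fun_cong[OF scale[OF f, of 0], of i] by (simp add: fun_scale_def)
    then show ?case by (simp add: fun_scale_def)
  next
    case (Suc k)
    then have k: "k < m" by simp
    have split: "(\<lambda>i. if i < Suc k then f i else 0) =
        (\<lambda>i. if i < k then f i else 0) + fun_scale (f k) (\<lambda>i. if i = k then 1 else 0)"
      by (auto simp: fun_eq_iff fun_scale_def less_Suc_eq)
    have "(\<lambda>i. if i < k then f i else 0) \<in> fun_space m"
      "fun_scale (f k) (\<lambda>i. if i = k then 1 else 0) \<in> fun_space m"
      using k by (auto simp: fun_space_def fun_scale_def)
    from fun_cong[OF add[OF this], of i] show ?case
      unfolding split scale[OF e[OF k]] using Suc.IH k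
      by (simp only: plus_fun_apply fun_scale_def sum.lessThan_Suc less_imp_le)
  qed
  from this[OF order_refl] have "N (\<lambda>i. if i < m then f i else 0) i =
      (\<Sum>j<m. f j * N (\<lambda>i. if i = j then 1 else 0) i)" .
  moreover have "(\<lambda>i. if i < m then f i else 0) = f"
    using f by (auto simp: fun_space_def fun_eq_iff)
  ultimately show ?thesis by (simp only:)
qed

text \<open>The bijection adds the identity to \<open>g\<close>: in characteristic 2,
  \<open>(1 + N) (1 + N) = 1 + N N\<close>, and an isometry that is its own inverse is
  self-adjoint.\<close>

lemma card_involutions_eq_sqzero:
  fixes \<beta> :: "'a::{field,finite} vec \<Rightarrow> 'a vec \<Rightarrow> 'a"
  assumes alt: "alternating_form m \<beta>" and char2: "(1::'a) + 1 = 0"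
  shows "card (involutions (symplectic_group m \<beta>)) =
    card (char2_alternating.sqzero fun_scale (vec_form m \<beta>) (fun_space m))"
proof -
  interpret char2_alternating "fun_scale :: 'a \<Rightarrow> _" "vec_form m \<beta>"
    using assms by (rule char2_alternating_vec_form)
  let ?V = "fun_space m :: (nat \<Rightarrow> 'a) set" and ?B = "vec_form m \<beta>"
  let ?I = "involutions (symplectic_group m \<beta>)"
  define L where "L g f = unvec m (g *\<^sub>v vec m f)" for g :: "'a mat" and f
  define T where "T g f = (if f \<in> ?V then L g f + f else 0)" for g f
  have sub_add: "f + h \<in> ?V" if "f \<in> ?V" "h \<in> ?V" for f h
    using that by (auto simp: fun_space_def)
  have sub_scale: "fun_scale c f \<in> ?V" if "f \<in> ?V" for f c
    using that by (auto simp: fun_space_def fun_scale_def)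
  note sub = sub_add sub_scale
  have gv: "g *\<^sub>v v \<in> carrier_vec m" if "g \<in> carrier_mat m m" for g and v :: "'a vec"
    using that by (metis carrier_matD(1) carrier_vecI dim_mult_mat_vec)
  have vecL: "vec m (L g f) = g *\<^sub>v vec m f" if "g \<in> carrier_mat m m" for g f
    unfolding L_def by (rule vec_unvec) (rule gv[OF that])
  have LV: "L g f \<in> ?V" for g f by (simp add: L_def)
  have L_add: "L g (f + h) = L g f + L g h" if "g \<in> carrier_mat m m" for g f h
    unfolding L_def vec_add
    using mult_add_distrib_mat_vec[OF that, of "vec m f" "vec m h"] unvec_add[OF gv[OF that] gv[OF that]] by simp
  have L_scale: "L g (fun_scale c f) = fun_scale c (L g f)" if "g \<in> carrier_mat m m" for g c f
    unfolding L_def vec_fun_scale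
    using mult_mat_vec[OF that, of "vec m f" c] unvec_smult[OF gv[OF that]] by simp
  have I: "g \<in> carrier_mat m m" "g * g = 1\<^sub>m m"
    "\<And>x y. x \<in> carrier_vec m \<Longrightarrow> y \<in> carrier_vec m \<Longrightarrow> \<beta> (g *\<^sub>v x) (g *\<^sub>v y) = \<beta> x y"
    if "g \<in> ?I" for g
    using that by (auto simp: involutions_symplectic_group)
  have LL: "L g (L g f) = f" if g: "g \<in> ?I" and f: "f \<in> ?V" for g f
  proof -
    have "L g (L g f) = unvec m ((g * g) *\<^sub>v vec m f)"
      unfolding L_def[of g "L g f"] vecL[OF I(1)[OF g]]
      using I(1)[OF g] by (simp add: assoc_mult_mat_vec[of _ m m _ m])
    then show ?thesis using I(2)[OF g] unvec_vec[OF f] by simp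
  qed
  have B_L: "?B (L g f) (L g h) = ?B f h" if g: "g \<in> ?I" for g f h
    using I(1,3)[OF g] by (simp add: vec_form_def vecL)
  have T_sqzero: "T g \<in> sqzero ?V" if g: "g \<in> ?I" for g
  proof (rule sqzeroI)
    note gc = I(1)[OF g]
    fix f h c assume f: "f \<in> ?V"
    show "T g f \<in> ?V" using f LV by (simp add: T_def sub)
    show "T g (T g f) = 0"
      using f LV LL[OF g f] by (simp add: T_def sub L_add[OF gc] add_ac)
    show "T g (fun_scale c f) = fun_scale c (T g f)"
      using f by (simp add: T_def sub L_scale[OF gc] scale_right_distrib)
    assume h: "h \<in> ?V"
    show "T g (f + h) = T g f + T g h"
      using f h by (simp add: T_def sub L_add[OF gc] add_ac)
    \<comment> \<open>Self-adjointness of \<open>g\<close> follows from the isometry property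
      applied to \<open>f\<close> and \<open>L g h\<close>, as \<open>g\<close> is its own
      inverse.\<close>
    have "?B (L g f) h = ?B f (L g h)"
      using B_L[OF g, of f "L g h"] LL[OF g h] by simp
    then show "?B (T g f) h = ?B f (T g h)"
      using f h by (simp add: T_def B_add_left B_add_right)
  qed (simp add: T_def)
  have inj: "inj_on T ?I"
  proof (rule inj_onI)
    fix g g' assume g: "g \<in> ?I" and g': "g' \<in> ?I" and eq: "T g = T g'"
    show "g = g'"
    proof (rule mat_eqI_mult_vec[OF I(1)[OF g] I(1)[OF g']])
      fix v :: "'a vec" assume v: "v \<in> carrier_vec m"
      have "L g (unvec m v) = L g' (unvec m v)"
        using fun_cong[OF eq, of "unvec m v"] by (simp add: T_def)
      then have "vec m (L g (unvec m v)) = vec m (L g' (unvec m v))" by simp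
      then show "g *\<^sub>v v = g' *\<^sub>v v"
        using vecL[OF I(1)[OF g]] vecL[OF I(1)[OF g']] vec_unvec[OF v] by simp
    qed
  qed
  have surj: "\<exists>g\<in>?I. T g = N" if N: "N \<in> sqzero ?V" for N
  proof
    define e :: "nat \<Rightarrow> nat \<Rightarrow> 'a" where "e j = (\<lambda>i. if i = j then 1 else 0)" for j
    \<comment> \<open>Column \<open>j\<close> of the preimage is \<open>N\<close> plus the identity
      applied to the unit function \<open>e j\<close>.\<close>
    define g where "g = mat m m (\<lambda>(i, j). N (e j) i + e j i)"
    have gc: "g \<in> carrier_mat m m" by (simp add: g_def)
    have gf: "g *\<^sub>v vec m f = vec m (N f + f)" if f: "f \<in> ?V" for f
    proof (rule eq_vecI)
      fix i assume "i < dim_vec (vec m (N f + f))"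
      then have i: "i < m" by simp
      have "(g *\<^sub>v vec m f) $ i = (\<Sum>j<m. (N (e j) i + e j i) * f j)"
        using i by (simp add: g_def scalar_prod_def atLeast0LessThan)
      also have "\<dots> = (\<Sum>j<m. f j * N (e j) i) + (\<Sum>j<m. if j = i then f j else 0)"
        unfolding sum.distrib[symmetric] by (rule sum.cong) (auto simp: e_def algebra_simps)
      also have "(\<Sum>j<m. f j * N (e j) i) = N f i"
        unfolding e_def by (rule additive_expansion[symmetric, OF sqzeroD(4)[OF N] sqzeroD(6)[OF N] f])
      also have "(\<Sum>j<m. if j = i then f j else 0) = f i" using i by simp
      finally show "(g *\<^sub>v vec m f) $ i = vec m (N f + f) $ i" using i by simp
    qed (simp add: g_def)
    have NV: "N f + f \<in> ?V" if "f \<in> ?V" for f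
      using sqzeroD(2)[OF N that] that by (simp add: sub)
    have NN: "N (N f + f) + (N f + f) = f" if f: "f \<in> ?V" for f
      using sqzeroD(2,3)[OF N f] f by (simp add: sqzeroD(4)[OF N] add_ac)
    have "T g f = N f" for f
    proof (cases "f \<in> ?V")
      case True
      then show ?thesis by (simp add: T_def L_def gf unvec_vec NV add.assoc)
    next
      case False
      then show ?thesis using sqzeroD(1)[OF N] by (simp add: T_def)
    qed
    then show "T g = N" by blast
    have "g * g = 1\<^sub>m m"
    proof (rule mat_eqI_mult_vec)
      fix v :: "'a vec" assume v: "v \<in> carrier_vec m"
      have "(g * g) *\<^sub>v v = g *\<^sub>v (g *\<^sub>v vec m (unvec m v))"
        using gc v by (simp add: assoc_mult_mat_vec[of _ m m _ m] vec_unvec)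
      also have "\<dots> = vec m (unvec m v)"
        by (simp only: gf[OF unvec_in_fun_space] gf[OF NV[OF unvec_in_fun_space]] NN[OF unvec_in_fun_space])
      finally show "(g * g) *\<^sub>v v = 1\<^sub>m m *\<^sub>v v" using v by (simp add: vec_unvec)
    qed (use gc in auto)
    moreover have "\<beta> (g *\<^sub>v x) (g *\<^sub>v y) = \<beta> x y" if x: "x \<in> carrier_vec m" and y: "y \<in> carrier_vec m" for x y
    proof -
      let ?f = "unvec m x" and ?h = "unvec m y"
      have V: "?f \<in> ?V" "?h \<in> ?V" by simp_all
      have "\<beta> (g *\<^sub>v x) (g *\<^sub>v y) = ?B (N ?f + ?f) (N ?h + ?h)"
        using gf[OF V(1)] gf[OF V(2)] by (simp add: vec_form_def vec_unvec x y)
      \<comment> \<open>The mixed terms are equal by self-adjointness and cancel in characteristic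
        2; the term in \<open>N ?f\<close> and \<open>N ?h\<close> then dies because
        \<open>N N = 0\<close>.\<close>
      also have "\<dots> = ?B (N ?f) (N ?h) + ?B ?f ?h"
        using sqzeroD(5)[OF N V] by (simp add: B_add_left B_add_right add_ac)
      also have "?B (N ?f) (N ?h) = 0"
        using sqzeroD(5)[OF N V(1) sqzeroD(2)[OF N V(2)]] sqzeroD(3)[OF N V(2)] by simp
      finally show ?thesis by (simp add: vec_form_def vec_unvec x y)
    qed
    ultimately show "g \<in> ?I" using gc by (simp add: involutions_symplectic_group)
  qed
  have "bij_betw T ?I (sqzero ?V)"
    using T_sqzero surj inj by (auto simp: bij_betw_def)
  then show ?thesis by (rule bij_betw_same_card)
qed

text \<open>For \<open>j < n\<close> both sides satisfy the same recurrence with a nonzero left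
  factor, which determines the value; \<open>j = n\<close> is the starting value, and for
  \<open>j > n\<close> both sides are \<open>0\<close>.\<close>

lemma (in char2_alternating) card_sqzero_ker:
  assumes "symplectic_space n V"
  shows "real (card (sqzero_ker V (CARD('a) ^ (n + j)))) = sqzero_count (real CARD('a)) j n"
  using assms
proof (induction n arbitrary: V rule: less_induct)
  case (less n)
  have q: "real CARD('a) \<ge> 2" "CARD('a) > 1" using card_field_gt_1[where 'a = 'a] by auto
  consider "j < n" | "j = n" | "j > n" by linarith
  then show ?case
  proof cases
    case 1
    have "real CARD('a) ^ (n + j) < real CARD('a) ^ (2 * n)"
      using 1 q(1) by (intro power_strict_increasing) auto
    then show ?thesis
      using card_sqzero_ker_recurrence[OF less.IH less.prems] sqzero_count_rec[OF q(1) 1]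
      by (metis (no_types, lifting) less_irrefl mult_right_cancel right_minus_eq)
  next
    case 2
    then show ?thesis using sqzero_ker_top[OF less.prems] sqzero_count_self[OF q(1)] by simp
  next
    case 3
    have "sqzero_ker V (CARD('a) ^ (n + j)) = {}"
    proof (rule equals0I)
      fix N assume "N \<in> sqzero_ker V (CARD('a) ^ (n + j))"
      then have N: "N \<in> sqzero V" "card (kernel_on V N) = CARD('a) ^ (n + j)"
        by (auto simp: sqzero_ker_def)
      obtain i where "i \<le> n" "CARD('a) ^ (n + j) = CARD('a) ^ (n + i)"
        using card_kernel_on_power[OF less.prems N(1)] N(2) by auto
      then show False using 3 q(2) by simp
    qed
    then show ?thesis using 3 q(1) by (simp add: sqzero_count_def)
  qed
qed

lemma card_involutions_symplectic_group:
  fixes \<beta> :: "'a::{field,finite} vec \<Rightarrow> 'a vec \<Rightarrow> 'a"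
  assumes alt: "alternating_form (2 * n) \<beta>" and nd: "nondegenerate_form (2 * n) \<beta>"
    and char2: "(1::'a) + 1 = 0"
  shows "real (card (involutions (symplectic_group (2 * n) \<beta>))) =
    (\<Sum>j\<le>n. sqzero_count (real CARD('a)) j n)"
proof -
  interpret char2_alternating "fun_scale :: 'a \<Rightarrow> _" "vec_form (2 * n) \<beta>"
    using alt char2 by (rule char2_alternating_vec_form)
  have "nondegenerate_on (fun_space (2 * n))"
    unfolding nondegenerate_on_def
  proof safe
    fix f :: "nat \<Rightarrow> 'a"
    assume f: "f \<in> fun_space (2 * n)" and z: "\<forall>h\<in>fun_space (2 * n). vec_form (2 * n) \<beta> f h = 0"
    have "\<beta> (vec (2 * n) f) y = 0" if "y \<in> carrier_vec (2 * n)" for y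
      using z[rule_format, of "unvec (2 * n) y"] that by (simp add: vec_form_def vec_unvec)
    then have "vec (2 * n) f = 0\<^sub>v (2 * n)" using nd by (simp add: nondegenerate_form_def)
    then have "unvec (2 * n) (vec (2 * n) f) = 0" by (auto simp: unvec_def fun_eq_iff)
    then show "f = 0" using unvec_vec[OF f] by simp
  qed
  then have V: "symplectic_space n (fun_space (2 * n))"
    by (simp add: symplectic_space_def subspace_fun_space card_fun_space)
  show ?thesis
    unfolding card_involutions_eq_sqzero[OF alt char2] card_sqzero_eq_sum[OF V]
    by (simp add: card_sqzero_ker[OF V])
qed

text \<open>Translation by \<open>1\<close> permutes the field, so \<open>q\<close> times \<open>1\<close> vanishes.\<close>

lemma char2_of_card:
  assumes "card (UNIV :: 'a::{field,finite} set) = 2 ^ k"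
  shows "(1::'a) + 1 = 0"
proof -
  have "bij (\<lambda>x::'a. x + 1)" by (rule bij_betw_byWitness[where f' = "\<lambda>x. x - 1"]) auto
  then have "(\<Sum>x::'a\<in>UNIV. x + 1) = (\<Sum>x\<in>UNIV. x)" by (rule sum.reindex_bij_betw)
  then have "of_nat (card (UNIV :: 'a set)) = (0::'a)" by (simp add: sum.distrib)
  then have "(2::'a) ^ k = 0" using assms by simp
  then show ?thesis by simp
qed

theorem theorem4p5:
  fixes q :: nat and B :: "nat \<Rightarrow> 'a::{field,finite} vec \<Rightarrow> 'a vec \<Rightarrow> 'a"
  assumes "\<exists>k\<ge>1. q = 2 ^ k"
    and "card (UNIV :: 'a set) = q"
    and "\<And>n. alternating_form (2 * n) (B n)"
    and "\<And>n. nondegenerate_form (2 * n) (B n)"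
  shows "(\<lambda>n. real (card (involutions (symplectic_group (2 * n) (B n)))) / real q ^ (n\<^sup>2 + n))
           \<longlonglongrightarrow> (\<Prod>i. 1 + 1 / real q ^ (2 * Suc i))"
proof -
  have char2: "(1::'a) + 1 = 0" using assms(1,2) char2_of_card by metis
  have "real q \<ge> 2" using card_field_gt_1[where 'a = 'a] assms(2) by auto
  then show ?thesis
    using sqzero_count_tendsto card_involutions_symplectic_group[OF assms(3,4) char2] assms(2) by simp
qed

end
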